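(* Let $K:[0,\infty)\to\mathbb{R}$ be Borel measurable, nonnegative with $K(0)=0$, bounded, having a right limit $K(0+)$ at zero and, if $K(0+)=0$, a finite right derivative at zero. Let the holding and shortage cost rate $h:\mathbb{R}\to[0,\infty)$ be Borel measurable and nondecreasing on $[0,\infty)$. Fix an initial inventory level $x\in\mathbb{R}$. Then for any admissible policy $Y\in\mathcal{U}$ there exists a sequence of admissible policies $\{Y_m\in\mathcal{U}_m:m=1,2,\ldots\}$ such that $$\lim_{m\to\infty}\operatorname{AC}(x,Y_m)\le\operatorname{AC}(x,Y).$$
   Context: Model. Fix $\mu>0$, $\sigma>0$, $k\ge 0$. Let $B$ be a standard Brownian motion on a filtered probability space $(\Omega,\mathcal{F},\mathbb{F},\mathbb{P})$ with filtration $\mathbb{F}=\{\mathcal{F}(t):t\ge0\}$ (an $\mathbb{F}$-Brownian motion). For $x\in\mathbb{R}$ put $X(t)=x-\mu t+\sigma B(t)$. An admissible ordering policy is an $\mathbb{F}$-adapted process $Y=\{Y(t):t\ge0\}$ whose sample paths are all nondecreasing, nonnegative, right-continuous on $[0,\infty)$ with left limits on $(0,\infty)$; $\mathcal{U}$ is the set of admissible policies. Conventions: $Y(0-)=0$, $Z(0-)=x$, $\Delta Y(t)=Y(t)-Y(t-)$. The inventory process is $Z(t)=X(t)+Y(t)$. The continuous part of $Y$ is $Y^c(t)=Y(t)-\sum_{0\le u\le t}\Delta Y(u)$. A time $t\ge0$ is an ordering time (of a sample path of $Y$) if $Y(u)-Y(t-)>0$ for all $u>t$. For $m=1,2,\ldots$,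 $\mathcal{U}_m=\{Y\in\mathcal{U}:Z(t)\le m\text{ for all ordering times }t\}$ (policies with order-up-to bound $m$). Costs. Put $\ell=\liminf_{\xi\downarrow0}K(\xi)/\xi\in[0,\infty]$ (so $\ell=\infty$ if $K(0+)>0$), with the convention $0\cdot\infty=0$. The long-run average cost (a value in $[0,\infty]$) is $$\operatorname{AC}(x,Y)=\limsup_{t\to\infty}\frac1t\,\mathbb{E}_x\Big[\int_0^t h(Z(u))\,du+\sum_{0\le u\le t}K(\Delta Y(u))+kY(t)+\ell Y^c(t)\Big],$$ where $\mathbb{E}_x$ denotes expectation given $Z(0-)=x$. *)

theory Defs
  imports "HOL-Probability.Probability"
begin

text \<open>
  Time is the half-line \<open>[0, \<infinity>)\<close>. Processes and filtrations are indexed by type \<open>real\<close>,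
  and their values at negative times are never constrained or used.
\<close>

locale filtered_prob_space = prob_space M
  for M :: "'a measure" +
  fixes F :: "real \<Rightarrow> 'a measure"
  assumes subalgebra_F: "\<And>t. 0 \<le> t \<Longrightarrow> subalgebra M (F t)"
    and F_mono: "\<And>s t. 0 \<le> s \<Longrightarrow> s \<le> t \<Longrightarrow> subalgebra (F t) (F s)"

text \<open>
  Every sample path is continuous, whereas the initial value is \<open>0\<close> almost surely. Neither
  completeness nor right-continuity of the filtration is assumed.
\<close>

locale brownian_motion = filtered_prob_space M F
  for M :: "'a measure" and F :: "real \<Rightarrow> 'a measure" +
  fixes B :: "real \<Rightarrow> 'a \<Rightarrow> real"
  assumes adapted: "\<And>t. 0 \<le> t \<Longrightarrow> B t \<in> borel_measurable (F t)"
    and start: "AE \<omega> in M. B 0 \<omega> = 0"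
    and continuous_paths: "\<And>\<omega>. \<omega> \<in> space M \<Longrightarrow> continuous_on {0..} (\<lambda>t. B t \<omega>)"
    and normal_increments: "\<And>s t. 0 \<le> s \<Longrightarrow> s < t \<Longrightarrow>
      distributed M lborel (\<lambda>\<omega>. B t \<omega> - B s \<omega>) (\<lambda>y. ennreal (normal_density 0 (sqrt (t - s)) y))"
    and indep_increments: "\<And>s t. 0 \<le> s \<Longrightarrow> s < t \<Longrightarrow>
      indep_set (sets (vimage_algebra (space M) (\<lambda>\<omega>. B t \<omega> - B s \<omega>) borel)) (sets (F s))"

definition admissible_policies ::
    "'a measure \<Rightarrow> (real \<Rightarrow> 'a measure) \<Rightarrow> (real \<Rightarrow> 'a \<Rightarrow> real) set" where
  "admissible_policies M F = {Y.
     (\<forall>t\<ge>0. Y t \<in> borel_measurable (F t)) \<and>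
     (\<forall>\<omega>\<in>space M.
        mono_on {0..} (\<lambda>t. Y t \<omega>) \<and>
        (\<forall>t\<ge>0. 0 \<le> Y t \<omega>) \<and>
        (\<forall>t\<ge>0. continuous (at_right t) (\<lambda>s. Y s \<omega>)) \<and>
        (\<forall>t>0. \<exists>l. ((\<lambda>s. Y s \<omega>) \<longlongrightarrow> l) (at_left t)))}"

text \<open>The following four definitions concern a single sample path \<open>y\<close> of a policy.\<close>

definition left_value :: "(real \<Rightarrow> real) \<Rightarrow> real \<Rightarrow> real" where
  "left_value y t = (if t \<le> 0 then 0 else Lim (at_left t) y)"
  \<comment> \<open>the convention \<open>y(0-) = 0\<close>; hence \<open>y(0)\<close> counts as a jump at time \<open>0\<close>\<close>

definition jump :: "(real \<Rightarrow> real) \<Rightarrow> real \<Rightarrow> real" where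
  "jump y t = y t - left_value y t"

definition continuous_part :: "(real \<Rightarrow> real) \<Rightarrow> real \<Rightarrow> real" where
  "continuous_part y t = y t - (\<Sum>\<^sub>\<infinity>u\<in>{0..t}. jump y u)"

definition ordering_time :: "(real \<Rightarrow> real) \<Rightarrow> real \<Rightarrow> bool" where
  "ordering_time y t \<longleftrightarrow> 0 \<le> t \<and> (\<forall>u>t. y u - left_value y t > 0)"

definition inventory ::
    "real \<Rightarrow> real \<Rightarrow> (real \<Rightarrow> 'a \<Rightarrow> real) \<Rightarrow> real \<Rightarrow> (real \<Rightarrow> 'a \<Rightarrow> real) \<Rightarrow> real \<Rightarrow> 'a \<Rightarrow> real" where
  "inventory \<mu> \<sigma> B x Y t \<omega> = (x - \<mu> * t + \<sigma> * B t \<omega>) + Y t \<omega>"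

definition bounded_policies ::
    "'a measure \<Rightarrow> (real \<Rightarrow> 'a measure) \<Rightarrow> real \<Rightarrow> real \<Rightarrow> (real \<Rightarrow> 'a \<Rightarrow> real) \<Rightarrow> real \<Rightarrow> nat
      \<Rightarrow> (real \<Rightarrow> 'a \<Rightarrow> real) set" where
  "bounded_policies M F \<mu> \<sigma> B x m = {Y \<in> admissible_policies M F.
     \<forall>\<omega>\<in>space M. \<forall>t. ordering_time (\<lambda>s. Y s \<omega>) t \<longrightarrow> inventory \<mu> \<sigma> B x Y t \<omega> \<le> real m}"

definition small_order_rate :: "(real \<Rightarrow> real) \<Rightarrow> ennreal" where
  "small_order_rate K = Liminf (at_right 0) (\<lambda>\<xi>. ennreal (K \<xi> / \<xi>))"

text \<open>
  Costs are formed in \<open>ennreal\<close>, where \<open>0 * \<infinity> = 0\<close>; in particular the last summand vanishes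
  when the continuous part does, even if \<open>small_order_rate K = \<infinity>\<close>.
\<close>

definition path_cost ::
    "(real \<Rightarrow> real) \<Rightarrow> (real \<Rightarrow> real) \<Rightarrow> real \<Rightarrow> (real \<Rightarrow> real) \<Rightarrow> (real \<Rightarrow> real) \<Rightarrow> real \<Rightarrow> ennreal" where
  "path_cost h K k z y t =
     (\<integral>\<^sup>+u\<in>{0..t}. ennreal (h (z u)) \<partial>lborel)
     + (\<Sum>\<^sub>\<infinity>u\<in>{0..t}. ennreal (K (jump y u)))
     + ennreal (k * y t)
     + small_order_rate K * ennreal (continuous_part y t)"

definition average_cost ::
    "'a measure \<Rightarrow> real \<Rightarrow> real \<Rightarrow> (real \<Rightarrow> 'a \<Rightarrow> real) \<Rightarrow> (real \<Rightarrow> real) \<Rightarrow> (real \<Rightarrow> real) \<Rightarrow> real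
      \<Rightarrow> real \<Rightarrow> (real \<Rightarrow> 'a \<Rightarrow> real) \<Rightarrow> ennreal" where
  "average_cost M \<mu> \<sigma> B h K k x Y =
     Limsup at_top (\<lambda>t. ennreal (1 / t) *
       (\<integral>\<^sup>+\<omega>. path_cost h K k (\<lambda>u. inventory \<mu> \<sigma> B x Y u \<omega>) (\<lambda>u. Y u \<omega>) t \<partial>M))"

end

theory Submission
  imports Defs
begin

text \<open>
  Follow the given policy until the inventory first reaches \<open>m\<close>; from then on place no orders until
  the inventory has sunk to \<open>0\<close>, having ordered at the beginning only what is needed to reach \<open>m\<close>.
  Then return to the given policy, or start again if its inventory is at least \<open>m\<close>. The modified
  inventory is never above the original one, and where they differ it is nonnegative, so holding
  and proportional costs do not increase; the continuous part does not increase either. Jumps cost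
  more only at the two ends of a cycle, at most \<open>sup K\<close> each. During a cycle the path
  \<open>x - \<mu> t + \<sigma> B(t)\<close> drops by at least \<open>m\<close>. The number of disjoint such drops in \<open>[0, t]\<close> is bounded
  by \<open>t / m\<close> plus the number of large increments over dyadic grids, and fourth moments show that its
  mean is at most a constant times \<open>t / m\<close>. Hence the average cost rises by \<open>O(1 / m)\<close> only, and
  near-minimisers over the increasing policy classes have convergent costs.
\<close>

section \<open>First hitting times of a predicate on the half-line\<close>

text \<open>The filtration need be neither complete nor right-continuous, so whether a cycle has
  begun or ended by time \<open>t\<close> must be decided exactly by the paths up to
  \<open>t\<close>. A random time is therefore represented by the predicate that it has passed,
  which needs no infinite value and whose truth at \<open>t\<close> can be shown to be an event of
  \<open>F t\<close>.

  The level 0 ends a cycle because \<open>h\<close> is monotone on the nonnegative half-line only: a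
  lower inventory is known to be cheaper only as long as it is nonnegative.

  The cycle times depend on \<open>Y\<close>, which may use all the information in the filtration.
  Their number is therefore bounded path by path through a functional of \<open>X\<close> alone, the
  number of large increments over deterministic grids, and its mean involves only single Brownian
  increments. The coarsest mesh is \<open>m\<close>: the drift needs a time of order
  \<open>m\<close> to bring the inventory down by \<open>m\<close>, and in such a time Brownian
  fluctuations are only of order \<open>sqrt m\<close>.\<close>

definition hit :: "(real \<Rightarrow> bool) \<Rightarrow> real \<Rightarrow> bool" where
  "hit P t \<longleftrightarrow> (\<exists>s. 0 \<le> s \<and> s \<le> t \<and> P s)"

text \<open>The complement contains, with each time \<open>t \<ge> 0\<close>, an interval
  \<open>[t, t + e)\<close>. Right-continuous paths yield such predicates, and an infimum of times
  satisfying one satisfies it too.\<close>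

definition right_closed :: "(real \<Rightarrow> bool) \<Rightarrow> bool" where
  "right_closed P \<longleftrightarrow> (\<forall>t\<ge>0. (\<forall>e>0. \<exists>s. t \<le> s \<and> s < t + e \<and> P s) \<longrightarrow> P t)"

lemma right_closedD:
  "right_closed P \<Longrightarrow> 0 \<le> t \<Longrightarrow> \<not> P t \<Longrightarrow> \<exists>e>0. \<forall>s. t \<le> s \<longrightarrow> s < t + e \<longrightarrow> \<not> P s"
  unfolding right_closed_def by meson

lemma right_closed_conj:
  "right_closed P \<Longrightarrow> right_closed Q \<Longrightarrow> right_closed (\<lambda>s. P s \<and> Q s)"
  unfolding right_closed_def by meson

lemma right_closed_ge:
  fixes w :: "real \<Rightarrow> real"
  assumes "\<And>t. 0 \<le> t \<Longrightarrow> continuous (at_right t) w"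
  shows "right_closed (\<lambda>s. a \<le> w s)"
  unfolding right_closed_def
proof (intro allI impI)
  fix t :: real assume t: "0 \<le> t" and near: "\<forall>e>0. \<exists>s. t \<le> s \<and> s < t + e \<and> a \<le> w s"
  show "a \<le> w t"
  proof (rule ccontr)
    assume "\<not> a \<le> w t"
    moreover have "(w \<longlongrightarrow> w t) (at_right t)" using assms[OF t] by (simp add: continuous_within)
    ultimately have "eventually (\<lambda>s. w s < a) (at_right t)" by (intro order_tendstoD) auto
    then obtain b where b: "t < b" "\<And>s. t < s \<Longrightarrow> s < b \<Longrightarrow> w s < a"
      unfolding eventually_at_right_field by blast
    obtain s where "t \<le> s" "s < t + (b - t)" "a \<le> w s" using near b(1) by (meson diff_gt_0_iff_gt)
    with b \<open>\<not> a \<le> w t\<close> show False by (cases "s = t") force+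
  qed
qed

lemma continuous_on_at_right:
  fixes f :: "real \<Rightarrow> real"
  assumes "continuous_on {0..} f" "0 \<le> t"
  shows "continuous (at_right t) f"
  using assms by (auto simp: continuous_on_eq_continuous_within intro: continuous_within_subset)

lemma hit_nonneg: "hit P t \<Longrightarrow> 0 \<le> t"
  unfolding hit_def by linarith

lemma hit_mono: "hit P s \<Longrightarrow> s \<le> t \<Longrightarrow> hit P t"
  unfolding hit_def using order_trans by blast

text \<open>The infimum of the times satisfying \<open>P\<close> is attained by right-closedness.
  Hence the predicate \<open>hit P\<close> and the time \<tau> carry the same information.\<close>

lemma hit_first:
  assumes "right_closed P" "hit P t"
  obtains \<tau> where "0 \<le> \<tau>" "P \<tau>" "\<And>s. hit P s \<longleftrightarrow> \<tau> \<le> s"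
proof -
  define A where "A = {s. 0 \<le> s \<and> P s}"
  define \<tau> where "\<tau> = Inf A"
  have A: "A \<noteq> {}" "bdd_below A" using assms(2) by (auto simp: A_def hit_def)
  have ge: "0 \<le> \<tau>" unfolding \<tau>_def by (rule cInf_greatest[OF A(1)]) (auto simp: A_def)
  have lb: "\<tau> \<le> s" if "s \<in> A" for s unfolding \<tau>_def by (rule cInf_lower[OF that A(2)])
  have P: "P \<tau>"
  proof (rule ccontr)
    assume "\<not> P \<tau>"
    then obtain e where e: "e > 0" "\<And>s. \<tau> \<le> s \<Longrightarrow> s < \<tau> + e \<Longrightarrow> \<not> P s"
      using right_closedD[OF assms(1) ge] by blast
    have "\<tau> + e \<le> \<tau>" unfolding \<tau>_def
    proof (rule cInf_greatest[OF A(1)])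
      fix s assume "s \<in> A" then show "Inf A + e \<le> s"
        using e(2)[of s] lb[of s] by (force simp: A_def \<tau>_def)
    qed
    with e(1) show False by simp
  qed
  have "hit P s \<longleftrightarrow> \<tau> \<le> s" for s
    using P ge lb by (fastforce simp: hit_def A_def)
  with ge P that show ?thesis by blast
qed

lemma right_closed_hit:
  assumes "right_closed P"
  shows "right_closed (hit P)"
  unfolding right_closed_def
proof (intro allI impI)
  fix t :: real assume near: "\<forall>e>0. \<exists>s. t \<le> s \<and> s < t + e \<and> hit P s"
  then obtain s where "hit P s" using zero_less_one by blast
  from hit_first[OF assms this] obtain \<tau> where \<tau>: "\<And>s. hit P s \<longleftrightarrow> \<tau> \<le> s" by blast
  have "\<tau> \<le> t + e" if "e > 0" for e using near that by (fastforce simp: \<tau>)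
  then show "hit P t" unfolding \<tau> by (rule field_le_epsilon)
qed

lemma Inf_hit:
  assumes "\<And>s. hit P s \<longleftrightarrow> \<tau> \<le> s"
  shows "Inf {s. hit P s} = \<tau>"
  by (simp add: assms flip: atLeast_def)

section \<open>The cycles of a path\<close>

text \<open>
  The predicates of time say that an event has happened: a cycle begins when the level \<open>z\<close>
  is at least \<open>m\<close>. During the cycle the cumulative order is held at \<open>frozen m X b\<close>, which brings
  the inventory to \<open>m\<close> at the beginning, and the cycle ends when the inventory has sunk to \<open>0\<close>.
\<close>

definition begun :: "real \<Rightarrow> (real \<Rightarrow> real) \<Rightarrow> (real \<Rightarrow> bool) \<Rightarrow> real \<Rightarrow> bool" where
  "begun m z e = hit (\<lambda>s. e s \<and> m \<le> z s)"

definition frozen :: "real \<Rightarrow> (real \<Rightarrow> real) \<Rightarrow> (real \<Rightarrow> bool) \<Rightarrow> real" where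
  "frozen m X b = max 0 (m - X (Inf {s. b s}))"

primrec ended :: "real \<Rightarrow> (real \<Rightarrow> real) \<Rightarrow> (real \<Rightarrow> real) \<Rightarrow> nat \<Rightarrow> real \<Rightarrow> bool" where
  "ended m X z 0 = (\<lambda>t. 0 \<le> t)"
| "ended m X z (Suc n) =
     hit (\<lambda>s. begun m z (ended m X z n) s \<and> X s \<le> - frozen m X (begun m z (ended m X z n)))"

text \<open>The predicates \<open>ended\<close> are nested, so the least index counts the cycles
  completed by time \<open>t\<close>; \<open>finitely_many_cycles\<close> supplies such an
  index.\<close>

definition cycles :: "real \<Rightarrow> (real \<Rightarrow> real) \<Rightarrow> (real \<Rightarrow> real) \<Rightarrow> real \<Rightarrow> nat" where
  "cycles m X z t = (LEAST n. \<not> ended m X z (Suc n) t)"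

text \<open>At the very moment a cycle ends the path is back at \<open>y\<close>, and a jump there
  makes up for the orders withheld. If that would lift the inventory to \<open>m\<close> or more,
  the next cycle begins at the same time and the jump leads to its frozen level instead.\<close>

definition capped_path :: "real \<Rightarrow> (real \<Rightarrow> real) \<Rightarrow> (real \<Rightarrow> real) \<Rightarrow> real \<Rightarrow> real" where
  "capped_path m X y t =
     (let z = \<lambda>s. X s + y s; b = begun m z (ended m X z (cycles m X z t))
      in if b t then frozen m X b else y t)"

section \<open>Begin and end times of the cycles of one path\<close>

locale ordering_path =
  fixes m :: real and X y :: "real \<Rightarrow> real"
  assumes m_pos: "0 < m"
    and X_continuous: "continuous_on {0..} X"
    and y_mono: "mono_on {0..} y"
    and y_nonneg: "\<And>t. 0 \<le> t \<Longrightarrow> 0 \<le> y t"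
    and y_right_continuous: "\<And>t. 0 \<le> t \<Longrightarrow> continuous (at_right t) y"
begin

definition E where "E n = ended m X (\<lambda>s. X s + y s) n"
definition A where "A n = begun m (\<lambda>s. X s + y s) (E n)"
definition c where "c n = frozen m X (A n)"
definition T where "T n = Inf {s. A n s}"
definition S where "S n = Inf {s. E (Suc n) s}"
definition N where "N t = cycles m X (\<lambda>s. X s + y s) t"
abbreviation y' where "y' \<equiv> capped_path m X y"

lemma capped_path_eq: "y' t = (if A (N t) t then c (N t) else y t)"
  by (simp add: capped_path_def N_def c_def A_def E_def Let_def)

lemma E_0: "E 0 t \<longleftrightarrow> 0 \<le> t" by (simp add: E_def)
lemma E_Suc: "E (Suc n) = hit (\<lambda>s. A n s \<and> X s \<le> - c n)" by (simp add: E_def A_def c_def)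
lemma A_eq: "A n = hit (\<lambda>s. E n s \<and> m \<le> X s + y s)" by (simp add: A_def begun_def)
lemma N_eq: "N t = (LEAST n. \<not> E (Suc n) t)" by (simp add: N_def cycles_def E_def)
lemma c_eq: "c n = max 0 (m - X (T n))" by (simp add: c_def frozen_def T_def)

lemma y_le: "0 \<le> s \<Longrightarrow> s \<le> t \<Longrightarrow> y s \<le> y t"
  using y_mono by (auto intro: mono_onD)

lemma right_closed_level: "right_closed (\<lambda>s. m \<le> X s + y s)"
  by (intro right_closed_ge continuous_add continuous_on_at_right[OF X_continuous] y_right_continuous)

lemma right_closed_X: "right_closed (\<lambda>s. X s \<le> a)"
  using right_closed_ge[of "\<lambda>s. - X s" "- a"] continuous_on_at_right[OF X_continuous]
  by (auto intro: continuous_minus)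

lemma right_closed_E_A: "right_closed (E n) \<and> right_closed (A n)"
proof (induction n)
  case 0
  have "right_closed (E 0)" by (simp add: right_closed_def E_0)
  then show ?case by (simp add: A_eq right_closed_hit right_closed_conj right_closed_level)
next
  case (Suc n)
  then have "right_closed (E (Suc n))"
    unfolding E_Suc by (intro right_closed_hit right_closed_conj right_closed_X) auto
  then show ?case by (simp add: A_eq right_closed_hit right_closed_conj right_closed_level)
qed

lemmas right_closed_E = right_closed_E_A[THEN conjunct1]
lemmas right_closed_A = right_closed_E_A[THEN conjunct2]

lemma E_mono: "E n s \<Longrightarrow> s \<le> t \<Longrightarrow> E n t"
  by (cases n) (auto simp: E_0 E_Suc intro: hit_mono)

lemma A_mono: "A n s \<Longrightarrow> s \<le> t \<Longrightarrow> A n t"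
  unfolding A_eq by (rule hit_mono)

lemma A_first:
  assumes "A n t"
  shows "0 \<le> T n" "E n (T n)" "m \<le> X (T n) + y (T n)" "A n s \<longleftrightarrow> T n \<le> s"
proof -
  have "right_closed (\<lambda>s. E n s \<and> m \<le> X s + y s)"
    by (intro right_closed_conj right_closed_E right_closed_level)
  from hit_first[OF this assms[unfolded A_eq]] obtain \<tau>
    where \<tau>: "0 \<le> \<tau>" "E n \<tau> \<and> m \<le> X \<tau> + y \<tau>" "\<And>s. A n s \<longleftrightarrow> \<tau> \<le> s"
    unfolding A_eq by metis
  moreover have "T n = \<tau>" using \<tau>(3) unfolding T_def A_eq by (intro Inf_hit) auto
  ultimately show "0 \<le> T n" "E n (T n)" "m \<le> X (T n) + y (T n)" "A n s \<longleftrightarrow> T n \<le> s" by auto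
qed

lemma E_first:
  assumes "E (Suc n) t"
  shows "A n (S n)" "X (S n) \<le> - c n" "E (Suc n) s \<longleftrightarrow> S n \<le> s"
proof -
  have "right_closed (\<lambda>s. A n s \<and> X s \<le> - c n)"
    by (intro right_closed_conj right_closed_A right_closed_X)
  from hit_first[OF this assms[unfolded E_Suc]] obtain \<tau>
    where \<tau>: "0 \<le> \<tau>" "A n \<tau> \<and> X \<tau> \<le> - c n" "\<And>s. E (Suc n) s \<longleftrightarrow> \<tau> \<le> s"
    unfolding E_Suc by metis
  moreover have "S n = \<tau>" using \<tau>(3) unfolding S_def E_Suc by (intro Inf_hit) auto
  ultimately show "A n (S n)" "X (S n) \<le> - c n" "E (Suc n) s \<longleftrightarrow> S n \<le> s" by auto
qed

lemma A_imp_E: "A n t \<Longrightarrow> E n t"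
  using A_first[of n t] E_mono by metis

lemma E_Suc_imp_A: "E (Suc n) t \<Longrightarrow> A n t"
  using E_first[of n t] A_mono by metis

lemma E_antimono: "i \<le> n \<Longrightarrow> E n t \<Longrightarrow> E i t"
  by (induction rule: dec_induct) (auto dest: E_Suc_imp_A A_imp_E)

lemma A_antimono: "i \<le> n \<Longrightarrow> A n t \<Longrightarrow> A i t"
  by (induction rule: dec_induct) (auto dest: E_Suc_imp_A A_imp_E)

text \<open>A cycle ends at the level \<open>- c n\<close>, and \<open>c n\<close> is at least
  \<open>m - X (T n)\<close>. The drop is one of \<open>X\<close> alone, which makes a count
  independent of the policy possible.\<close>

lemma drop:
  assumes "E (Suc n) t"
  shows "X (S n) \<le> X (T n) - m" "T n < S n" "S n \<le> t"
proof -
  show d: "X (S n) \<le> X (T n) - m" using E_first(2)[OF assms] by (auto simp: c_eq max_def split: if_splits)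
  have "T n \<le> S n" using E_first(1)[OF assms] A_first(4) by blast
  moreover have "T n \<noteq> S n" using d m_pos by auto
  ultimately show "T n < S n" by simp
  show "S n \<le> t" using E_first(3)[OF assms] assms by blast
qed

lemma S_le_T: "A (Suc n) t \<Longrightarrow> S n \<le> T (Suc n)"
  using A_first(2) E_first(3) by blast

text \<open>Infinitely many cycles before \<open>t\<close> would make the interlaced times
  \<open>T n\<close> and \<open>S n\<close> converge to a common limit, where drops of size
  \<open>m\<close> contradict the continuity of \<open>X\<close>.\<close>

lemma finitely_many_cycles: "\<exists>n. \<not> E (Suc n) t"
proof (rule ccontr)
  assume "\<not> ?thesis"
  then have all: "E (Suc n) t" for n by blast
  note d = drop[OF all]
  have ST: "S n \<le> T (Suc n)" for n by (rule S_le_T[OF E_Suc_imp_A[OF all]])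
  have T0: "0 \<le> T n" for n by (rule A_first(1)[OF E_Suc_imp_A[OF all]])
  have "incseq T" by (rule incseq_SucI) (use d(2) ST in \<open>meson less_imp_le order_trans\<close>)
  moreover have "T n \<le> t" for n using d(2,3)[of n] by simp
  ultimately obtain l where l: "T \<longlonglongrightarrow> l" using incseq_convergent[of T t] by blast
  have l0: "0 \<le> l" using LIMSEQ_le_const[OF l] T0 by blast
  have "S \<longlonglongrightarrow> l"
    by (rule tendsto_sandwich[OF _ _ l LIMSEQ_Suc[OF l]]) (use d(2) ST in \<open>auto intro: always_eventually less_imp_le\<close>)
  moreover have "0 \<le> S n" for n using T0[of n] d(2)[of n] by simp
  ultimately have "(\<lambda>n. X (T n) - X (S n)) \<longlonglongrightarrow> X l - X l"
    using l l0 T0 by (intro tendsto_diff continuous_on_tendsto_compose[OF X_continuous]) auto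
  then have "m \<le> X l - X l" by (rule LIMSEQ_le_const) (use d(1) in \<open>force simp: algebra_simps\<close>)
  then show False using m_pos by simp
qed

lemma less_N_iff: "n < N t \<longleftrightarrow> E (Suc n) t"
proof
  assume "n < N t" then show "E (Suc n) t" unfolding N_eq using not_less_Least by blast
next
  have "\<not> E (Suc (N t)) t" unfolding N_eq using finitely_many_cycles by (rule LeastI_ex)
  moreover assume "E (Suc n) t"
  ultimately show "n < N t" using E_antimono[of "Suc (N t)" "Suc n" t] by (meson Suc_le_mono not_le)
qed

lemma E_N: "0 \<le> t \<Longrightarrow> E (N t) t"
  by (cases "N t") (auto simp: E_0 less_N_iff[symmetric])

lemma not_E_N: "\<not> E (Suc (N t)) t"
  using less_N_iff by blast

lemma N_mono: "s \<le> t \<Longrightarrow> N s \<le> N t"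
  using less_N_iff E_mono by (metis less_irrefl not_le)

section \<open>Monotonicity, switching times and right-continuity of the capped path\<close>

lemma c_le_y: "A n t \<Longrightarrow> c n \<le> y t"
proof -
  assume a: "A n t"
  have "c n \<le> y (T n)" using A_first[OF a] y_nonneg by (simp add: c_eq)
  also have "\<dots> \<le> y t" using A_first[OF a] a by (intro y_le) auto
  finally show ?thesis .
qed

lemma capped_le: "y' t \<le> y t"
  using c_le_y by (simp add: capped_path_eq)

lemma capped_nonneg: "0 \<le> t \<Longrightarrow> 0 \<le> y' t"
  using y_nonneg by (simp add: capped_path_eq c_eq)

text \<open>If \<open>y s\<close> exceeded \<open>c n\<close>, then \<open>X + y s\<close> would
  exceed \<open>m\<close> at \<open>T n\<close> and, by continuity of \<open>X\<close>, already a
  little earlier; as \<open>y\<close> has at least the value \<open>y s\<close> there, the cycle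
  would have begun before \<open>T n\<close>.\<close>

lemma y_le_c:
  assumes "E n s" "\<not> A n s" "A n u" "0 \<le> s"
  shows "y s \<le> c n"
proof (rule ccontr)
  assume neg: "\<not> y s \<le> c n"
  note f = A_first[OF assms(3)]
  have sT: "s < T n" using f(4) assms(2) by auto
  have "m - y s < X (T n)" using neg by (auto simp: c_eq)
  moreover have "(X \<longlongrightarrow> X (T n)) (at (T n) within {0..})"
    using X_continuous f(1) by (simp add: continuous_on_def)
  then have "(X \<longlongrightarrow> X (T n)) (at (T n) within {s..<T n})"
    by (rule tendsto_within_subset) (use assms(4) in auto)
  ultimately have "eventually (\<lambda>v. m - y s < X v) (at (T n) within {s..<T n})"
    by (intro order_tendstoD)
  then obtain d where d: "d > 0" "\<And>v. v \<in> {s..<T n} \<Longrightarrow> v \<noteq> T n \<Longrightarrow> dist v (T n) < d \<Longrightarrow> m - y s < X v"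
    unfolding eventually_at by blast
  define v where "v = max s (T n - d / 2)"
  have v: "s \<le> v" "v < T n" "m - y s < X v"
    using sT d(1) by (auto simp: v_def dist_real_def intro!: d(2))
  have "m \<le> X v + y v" using v(3) y_le[OF assms(4) v(1)] by simp
  moreover have "E n v" using assms(1) v(1) E_mono by blast
  ultimately have "A n v" unfolding A_eq hit_def using v(1) assms(4) by (intro exI[of _ v]) auto
  then show False using f(4) v(2) by auto
qed

text \<open>If the next cycle begins at once, \<open>X\<close> is at most \<open>- c n\<close> there
  and the new level is even at least \<open>m + c n\<close>. Otherwise the path follows
  \<open>y\<close> at time \<open>S n\<close>, and \<open>y (S n)\<close> lies between the two
  levels.\<close>

lemma c_Suc: "A (Suc n) u \<Longrightarrow> c n \<le> c (Suc n)"
proof -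
  assume a: "A (Suc n) u"
  note e = E_first[OF A_first(2)[OF a]] and f = A_first[OF a]
  have le: "S n \<le> T (Suc n)" by (rule S_le_T[OF a])
  show ?thesis
  proof (cases "S n = T (Suc n)")
    case True
    then have "X (T (Suc n)) \<le> - c n" using e(2) by simp
    then show ?thesis using m_pos by (simp add: c_eq[of "Suc n"])
  next
    case False
    have "0 \<le> S n" using e(1) unfolding A_eq by (rule hit_nonneg)
    moreover have "E (Suc n) (S n)" using e(3) by simp
    moreover have "\<not> A (Suc n) (S n)" using f(4) False le by simp
    ultimately have "y (S n) \<le> c (Suc n)" using a by (intro y_le_c)
    then show ?thesis using c_le_y[OF e(1)] by simp
  qed
qed

lemma c_mono: "i \<le> n \<Longrightarrow> A n u \<Longrightarrow> c i \<le> c n"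
proof (induction rule: dec_induct)
  case (step k)
  have "A k u" using A_antimono[of k "Suc k"] step.prems by simp
  then show ?case using c_Suc[OF step.prems] step.IH by simp
qed simp

lemma capped_mono: "0 \<le> s \<Longrightarrow> s \<le> t \<Longrightarrow> y' s \<le> y' t"
proof (cases "A (N t) t")
  case True
  assume s: "0 \<le> s" "s \<le> t"
  have Ns: "N s \<le> N t" by (rule N_mono[OF s(2)])
  have "y' s \<le> c (N s)"
    using y_le_c[OF E_N[OF s(1)] _ A_antimono[OF Ns True] s(1)] by (auto simp: capped_path_eq)
  also have "\<dots> \<le> c (N t)" by (rule c_mono[OF Ns True])
  finally show ?thesis using True by (simp add: capped_path_eq)
next
  case False
  assume s: "0 \<le> s" "s \<le> t"
  show ?thesis using capped_le[of s] y_le[OF s] False by (simp add: capped_path_eq)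
qed

text \<open>The existence clauses discard cycles that never begin or never end, for which
  \<open>T n\<close> or \<open>S n\<close> is the infimum of an empty set.\<close>

definition switches where
  "switches = {T n | n. \<exists>u. A n u} \<union> {S n | n. \<exists>u. E (Suc n) u}"

lemma same_mode:
  assumes "0 \<le> a" "a \<le> b" "{a<..b} \<inter> switches = {}"
  shows "N a = N b" "A (N b) a \<longleftrightarrow> A (N b) b"
proof -
  have E: "E (Suc n) a \<longleftrightarrow> E (Suc n) b" for n
  proof
    assume e: "E (Suc n) b"
    then have "S n \<le> a" using E_first(3)[OF e] assms(3) by (force simp: switches_def)
    then show "E (Suc n) a" using E_first(3)[OF e] by simp
  qed (use E_mono assms(2) in blast)
  then show "N a = N b" unfolding N_eq by (simp only: E)
  show "A (N b) a \<longleftrightarrow> A (N b) b"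
  proof
    assume e: "A (N b) b"
    then have "T (N b) \<le> a" using A_first(4)[OF e] assms(3) by (force simp: switches_def)
    then show "A (N b) a" using A_first(4)[OF e] by simp
  qed (use A_mono assms(2) in blast)
qed

text \<open>The ends are those of the \<open>N t\<close> completed cycles; the extra 1 is for the
  beginning of a cycle still running at time \<open>t\<close>.\<close>

lemma finite_switches: "finite (switches \<inter> {0..t})" "card (switches \<inter> {0..t}) \<le> 2 * N t + 1"
proof -
  have sub: "switches \<inter> {0..t} \<subseteq> T ` {..N t} \<union> S ` {..<N t}"
  proof
    fix u assume u: "u \<in> switches \<inter> {0..t}"
    consider n v where "u = T n" "A n v" | n v where "u = S n" "E (Suc n) v"
      using u by (auto simp: switches_def)
    then show "u \<in> T ` {..N t} \<union> S ` {..<N t}"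
    proof cases
      case 1
      have "A n t" using 1 u A_first(4) by auto
      then have "n \<le> N t" using A_imp_E[of n t] less_N_iff by (cases n) (auto simp: Suc_le_eq)
      then show ?thesis using 1 by auto
    next
      case 2
      then have "E (Suc n) t" using u E_first(3) by auto
      then show ?thesis using 2 less_N_iff by auto
    qed
  qed
  then show "finite (switches \<inter> {0..t})" by (rule finite_subset) auto
  have "card (switches \<inter> {0..t}) \<le> card (T ` {..N t} \<union> S ` {..<N t})"
    by (rule card_mono[OF _ sub]) auto
  also have "\<dots> \<le> card (T ` {..N t}) + card (S ` {..<N t})" by (rule card_Un_le)
  also have "\<dots> \<le> Suc (N t) + N t"
    using card_image_le[of "{..N t}" T] card_image_le[of "{..<N t}" S] by (intro add_mono) auto
  finally show "card (switches \<inter> {0..t}) \<le> 2 * N t + 1" by simp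
qed

text \<open>What has happened stays so, and by right-closedness what has not happened by time
  \<open>t\<close> does not happen immediately afterwards.\<close>

lemma right_mode:
  assumes "0 \<le> t"
  obtains e where "e > 0" "\<And>s. t \<le> s \<Longrightarrow> s < t + e \<Longrightarrow> N s = N t"
    "\<And>s. t \<le> s \<Longrightarrow> s < t + e \<Longrightarrow> A (N t) s \<longleftrightarrow> A (N t) t"
proof -
  obtain e1 where e1: "e1 > 0" "\<And>s. t \<le> s \<Longrightarrow> s < t + e1 \<Longrightarrow> \<not> E (Suc (N t)) s"
    using right_closedD[OF right_closed_E assms not_E_N] by blast
  have N: "N s = N t" if "t \<le> s" "s < t + e1" for s
    using e1(2)[OF that] N_mono[OF that(1)] less_N_iff[of "N t" s] by auto
  show ?thesis
  proof (cases "A (N t) t")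
    case True
    then have "A (N t) s \<longleftrightarrow> A (N t) t" if "t \<le> s" for s using A_mono[OF True that] by simp
    then show ?thesis by (intro that[OF e1(1) N])
  next
    case False
    obtain e2 where e2: "e2 > 0" "\<And>s. t \<le> s \<Longrightarrow> s < t + e2 \<Longrightarrow> \<not> A (N t) s"
      using right_closedD[OF right_closed_A assms False] by blast
    show ?thesis
    proof (rule that[of "min e1 e2"])
      show "N s = N t" if "t \<le> s" "s < t + min e1 e2" for s using that by (intro N) auto
      show "A (N t) s \<longleftrightarrow> A (N t) t" if "t \<le> s" "s < t + min e1 e2" for s
        using that False e2(2)[of s] by simp
    qed (use e1(1) e2(1) in simp)
  qed
qed

lemma capped_right_continuous:
  assumes "0 \<le> t"
  shows "continuous (at_right t) y'"
proof -
  obtain e where e: "e > 0" "\<And>s. t \<le> s \<Longrightarrow> s < t + e \<Longrightarrow> N s = N t"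
    "\<And>s. t \<le> s \<Longrightarrow> s < t + e \<Longrightarrow> A (N t) s \<longleftrightarrow> A (N t) t"
    using right_mode[OF assms] by blast
  have ev: "eventually (\<lambda>s. t \<le> s \<and> s < t + e) (at_right t)"
    unfolding eventually_at_right_field using e(1) by (intro exI[of _ "t + e"]) auto
  have "((\<lambda>s. if A (N t) t then c (N t) else y s) \<longlongrightarrow> (if A (N t) t then c (N t) else y t)) (at_right t)"
    using y_right_continuous[OF assms] by (auto simp: continuous_within)
  then have "(y' \<longlongrightarrow> (if A (N t) t then c (N t) else y t)) (at_right t)"
  proof (rule Lim_transform_eventually)
    show "\<forall>\<^sub>F s in at_right t. (if A (N t) t then c (N t) else y s) = y' s"
      using ev
    proof eventually_elim
      case (elim s)
      have "N s = N t" "A (N t) s \<longleftrightarrow> A (N t) t" using e(2,3) elim by blast+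
      then show ?case by (simp only: capped_path_eq)
    qed
  qed
  then show ?thesis by (simp add: continuous_within capped_path_eq)
qed

end

section \<open>Left limits, jumps and continuous parts\<close>

lemma left_value_eqI:
  "0 < t \<Longrightarrow> (g \<longlongrightarrow> l) (at_left t) \<Longrightarrow> left_value g t = l" for g :: "real \<Rightarrow> real"
  by (simp add: left_value_def tendsto_Lim)

lemma mono_on_left_limit:
  fixes g :: "real \<Rightarrow> real"
  assumes "mono_on {0..} g" "0 < t"
  shows "\<exists>l. (g \<longlongrightarrow> l) (at_left t)"
proof -
  define l where "l = Sup (g ` {0..<t})"
  have bdd: "bdd_above (g ` {0..<t})"
    using assms by (intro bdd_aboveI[of _ "g t"]) (auto intro: mono_onD)
  have "(g \<longlongrightarrow> l) (at_left t)"
  proof (rule order_tendstoI)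
    fix a assume "a < l"
    then obtain s where s: "0 \<le> s" "s < t" "a < g s"
      unfolding l_def using less_cSup_iff[OF _ bdd] assms(2) by force
    have "a < g u" if "s < u" "u < t" for u
      using s that mono_onD[OF assms(1), of s u] by auto
    then show "\<forall>\<^sub>F x in at_left t. a < g x"
      unfolding eventually_at_left_field using s(2) by blast
  next
    fix a assume "l < a"
    have "g u < a" if "0 < u" "u < t" for u
      using \<open>l < a\<close> cSup_upper[OF _ bdd, of "g u"] that by (force simp: l_def)
    then show "\<forall>\<^sub>F x in at_left t. g x < a"
      unfolding eventually_at_left_field using assms(2) by blast
  qed
  then show ?thesis by blast
qed

lemma left_value_tendsto:
  fixes g :: "real \<Rightarrow> real"
  assumes "mono_on {0..} g" "0 < t"
  shows "(g \<longlongrightarrow> left_value g t) (at_left t)"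
  using mono_on_left_limit[OF assms] left_value_eqI[OF assms(2)] by metis

lemma left_value_ge:
  fixes g :: "real \<Rightarrow> real"
  assumes "(g \<longlongrightarrow> l) (at_left t)" "s < t" "\<And>u. s < u \<Longrightarrow> u < t \<Longrightarrow> a \<le> g u"
  shows "a \<le> l"
proof (rule tendsto_lowerbound[OF assms(1)])
  show "\<forall>\<^sub>F u in at_left t. a \<le> g u"
    unfolding eventually_at_left_field using assms(2,3) by blast
qed simp

lemma left_value_nonneg:
  fixes g :: "real \<Rightarrow> real"
  assumes "mono_on {0..} g" "\<And>t. 0 \<le> t \<Longrightarrow> 0 \<le> g t"
  shows "0 \<le> left_value g t"
proof (cases "0 < t")
  case True
  show ?thesis by (rule left_value_ge[OF left_value_tendsto[OF assms(1) True] True]) (use assms in auto)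
qed (simp add: left_value_def)

lemma left_value_le:
  fixes g :: "real \<Rightarrow> real"
  assumes "mono_on {0..} g" "\<And>t. 0 \<le> t \<Longrightarrow> 0 \<le> g t" "0 \<le> t"
  shows "left_value g t \<le> g t"
proof (cases "0 < t")
  case True
  show ?thesis
  proof (rule tendsto_upperbound[OF left_value_tendsto[OF assms(1) True]])
    show "\<forall>\<^sub>F u in at_left t. g u \<le> g t"
      unfolding eventually_at_left_field using True assms(1) by (intro exI[of _ 0]) (auto intro: mono_onD)
  qed simp
qed (use assms in \<open>simp add: left_value_def\<close>)

lemma jump_nonneg:
  "mono_on {0..} g \<Longrightarrow> (\<And>t. 0 \<le> t \<Longrightarrow> 0 \<le> g t) \<Longrightarrow> 0 \<le> t \<Longrightarrow> 0 \<le> jump g t"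
  using left_value_le by (simp add: jump_def)

text \<open>
  Applied to a monotone path this bounds sums of jumps; applied to the difference of a path and
  its capped version, which is monotone off the switching times, it compares continuous parts.
\<close>

lemma sum_jump_le:
  fixes g :: "real \<Rightarrow> real"
  assumes "finite D" "D \<subseteq> {0..}"
    and lim: "\<And>u. 0 < u \<Longrightarrow> u \<le> r \<Longrightarrow> \<exists>l. (g \<longlongrightarrow> l) (at_left u)"
    and mono: "\<And>a b. 0 \<le> a \<Longrightarrow> a \<le> b \<Longrightarrow> b \<le> r \<Longrightarrow> {a<..b} \<inter> D = {} \<Longrightarrow> g a \<le> g b"
    and g0: "0 \<le> g 0"
    and "0 \<le> t" "t \<le> r"
  shows "(\<Sum>u\<in>D \<inter> {0..t}. jump g u) \<le> g t"
  using \<open>0 \<le> t\<close> \<open>t \<le> r\<close>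
proof (induction "card (D \<inter> {0..t})" arbitrary: t)
  case 0
  then have e: "D \<inter> {0..t} = {}" using assms(1) by simp
  then have "g 0 \<le> g t" using 0 by (intro mono) auto
  then show ?case using g0 e by simp
next
  case (Suc n)
  define A where "A = D \<inter> {0..t}"
  have fin: "finite A" "A \<noteq> {}" using assms(1) Suc(2) by (auto simp: A_def)
  define b where "b = Max A"
  have b: "b \<in> A" "\<And>u. u \<in> A \<Longrightarrow> u \<le> b" using Max_in[OF fin] Max_ge[OF fin(1)] by (auto simp: b_def)
  have bt: "0 \<le> b" "b \<le> t" using b(1) by (auto simp: A_def)
  have gb: "g b \<le> g t" using b(2) bt Suc(4) by (intro mono) (force simp: A_def)+
  have le: "(\<Sum>u\<in>A - {b}. jump g u) \<le> left_value g b"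
  proof (cases "b = 0")
    case True
    then have "A - {b} = {}" using b(2) by (force simp: A_def)
    then show ?thesis using True by (simp only: sum.empty) (simp add: left_value_def)
  next
    case False
    then have b0: "0 < b" using bt by simp
    \<comment> \<open>The point of \<open>D\<close> preceding \<open>b\<close>, or the starting time
      0 if there is none. The induction hypothesis applies at \<open>a\<close>, and between
      \<open>a\<close> and \<open>b\<close> the path does not decrease, so its left limit at
      \<open>b\<close> is at least \<open>g a\<close>.\<close>
    define a where "a = Max (insert 0 (A - {b}))"
    have "finite (insert 0 (A - {b}))" using fin by simp
    from Max_in[OF this] Max_ge[OF this]
    have a: "a \<in> insert 0 (A - {b})" "\<And>u. u \<in> insert 0 (A - {b}) \<Longrightarrow> u \<le> a"
      unfolding a_def by blast+
    have ab: "0 \<le> a" "a < b" using a b(2) b0 by (auto simp: less_le)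
    have eq: "D \<inter> {0..a} = A - {b}" using a(2) ab bt b(2) by (force simp: A_def)
    have gap: "u \<le> a" if "u \<in> D" "0 \<le> u" "u < b" for u
      using a(2)[of u] that bt by (auto simp: A_def)
    have "n = card (A - {b})" using Suc(2) fin b(1) by (simp add: A_def[symmetric])
    then have "(\<Sum>u\<in>A - {b}. jump g u) \<le> g a" using Suc(1)[of a] Suc(4) bt ab eq by simp
    also obtain l where l: "(g \<longlongrightarrow> l) (at_left b)" using lim[OF b0] bt Suc(4) by force
    have "g a \<le> l" by (rule left_value_ge[OF l ab(2)]) (use gap ab bt Suc(4) in \<open>force intro!: mono\<close>)
    also have "l = left_value g b" using left_value_eqI[OF b0 l] by simp
    finally show ?thesis .
  qed
  have "(\<Sum>u\<in>A. jump g u) = jump g b + (\<Sum>u\<in>A - {b}. jump g u)"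
    using fin b(1) by (simp add: sum.remove)
  also have "\<dots> \<le> jump g b + left_value g b" using le by simp
  also have "\<dots> = g b" by (simp add: jump_def)
  finally show ?case using gb by (simp add: A_def)
qed

lemma sum_jump_le_mono:
  fixes g :: "real \<Rightarrow> real"
  assumes "mono_on {0..} g" "\<And>t. 0 \<le> t \<Longrightarrow> 0 \<le> g t" "finite D" "D \<subseteq> {0..t}" "0 \<le> t"
  shows "sum (jump g) D \<le> g t"
proof -
  have "(\<Sum>u\<in>D \<inter> {0..t}. jump g u) \<le> g t"
    using assms by (intro sum_jump_le[where r = t] mono_on_left_limit) (auto intro: mono_onD)
  moreover have "D \<inter> {0..t} = D" using assms(4) by auto
  ultimately show ?thesis by simp
qed

lemma jump_summable:
  fixes g :: "real \<Rightarrow> real"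
  assumes "mono_on {0..} g" "\<And>t. 0 \<le> t \<Longrightarrow> 0 \<le> g t" "0 \<le> t"
  shows "jump g summable_on {0..t}"
proof (rule nonneg_bdd_above_summable_on)
  show "0 \<le> jump g u" if "u \<in> {0..t}" for u using jump_nonneg[OF assms(1,2)] that by auto
  show "bdd_above (sum (jump g) ` {F. F \<subseteq> {0..t} \<and> finite F})"
    using sum_jump_le_mono[OF assms(1,2) _ _ assms(3)] by (intro bdd_aboveI[of _ "g t"]) auto
qed

context ordering_path
begin

lemma y_mono': "mono_on {0..} y'"
  using capped_mono by (intro mono_onI) auto

lemma left_mode:
  assumes "0 < t" "t \<notin> switches"
  obtains e where "0 \<le> e" "e < t" "{e<..t} \<inter> switches = {}"
proof -
  define e where "e = Max (insert 0 (switches \<inter> {0..t}))"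
  have fin: "finite (insert 0 (switches \<inter> {0..t}))" using finite_switches by simp
  have e: "e \<in> insert 0 (switches \<inter> {0..t})" "\<And>u. u \<in> insert 0 (switches \<inter> {0..t}) \<Longrightarrow> u \<le> e"
    unfolding e_def using Max_in[OF fin] Max_ge[OF fin] by blast+
  show ?thesis
  proof (rule that[of e])
    show "0 \<le> e" by (rule e(2)) simp
    show "e < t" using e(1) assms by (auto simp: less_le)
    show "{e<..t} \<inter> switches = {}"
    proof (rule equals0I)
      fix u assume "u \<in> {e<..t} \<inter> switches"
      then show False using e(2)[of u] \<open>0 \<le> e\<close> by auto
    qed
  qed
qed

text \<open>Just before a time that is no switch the mode is already the same, so the capped path is
  constant there or equal to \<open>y\<close>. Time 0 has no past and is treated apart: a cycle
  running at 0 would make 0 a switch.\<close>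

lemma jump_capped:
  assumes "0 \<le> t" "t \<notin> switches"
  shows "jump y' t = (if A (N t) t then 0 else jump y t)"
proof (cases "t = 0")
  case True
  have "\<not> A (N 0) 0"
  proof
    assume a: "A (N 0) 0"
    then have "T (N 0) = 0" using A_first(1,4)[OF a] by (auto simp: antisym)
    then show False using a assms(2) True by (force simp: switches_def)
  qed
  then show ?thesis using True by (simp add: jump_def left_value_def capped_path_eq)
next
  case False
  then have t: "0 < t" using assms by simp
  obtain e where e: "0 \<le> e" "e < t" "{e<..t} \<inter> switches = {}" using left_mode[OF t assms(2)] by blast
  have eq: "y' s = (if A (N t) t then c (N t) else y s)" if "e < s" "s \<le> t" for s
  proof -
    have "{s<..t} \<inter> switches = {}" using e(3) that(1) by (force simp: disjoint_iff)
    from same_mode[OF _ that(2) this] show ?thesis using e(1) that by (simp add: capped_path_eq)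
  qed
  have "((\<lambda>s. if A (N t) t then c (N t) else y s) \<longlongrightarrow> (if A (N t) t then c (N t) else left_value y t)) (at_left t)"
    using left_value_tendsto[OF y_mono t] by auto
  then have "(y' \<longlongrightarrow> (if A (N t) t then c (N t) else left_value y t)) (at_left t)"
  proof (rule Lim_transform_eventually)
    show "\<forall>\<^sub>F s in at_left t. (if A (N t) t then c (N t) else y s) = y' s"
      unfolding eventually_at_left_field using e(2) by (intro exI[of _ e]) (simp add: eq)
  qed
  then show ?thesis using left_value_eqI[OF t] by (simp add: jump_def capped_path_eq)
qed

text \<open>Between switches \<open>y - y'\<close> is either zero or \<open>y\<close> minus a
  constant, hence nondecreasing; it may fall only at switches. So it dominates the sum of its own
  jumps over every finite set that contains all switches up to \<open>t\<close>, and the claim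
  follows by passing to infinite sums.\<close>

lemma continuous_part_capped_le:
  assumes "0 \<le> t"
  shows "continuous_part y' t \<le> continuous_part y t"
proof -
  define g where "g = (\<lambda>s. y s - y' s)"
  have left_g: "left_value g u = left_value y u - left_value y' u" if "0 \<le> u" for u
  proof (cases "u = 0")
    case False
    then show ?thesis using that unfolding g_def
      by (intro left_value_eqI tendsto_diff left_value_tendsto y_mono y_mono') auto
  qed (simp add: left_value_def)
  have main: "y' t - sum (jump y') D \<le> y t - sum (jump y) D"
    if D: "finite D" "D \<subseteq> {0..t}" "switches \<inter> {0..t} \<subseteq> D" for D
  proof -
    have "(\<Sum>u\<in>D \<inter> {0..t}. jump g u) \<le> g t"
    proof (rule sum_jump_le[where r = t])
      show "\<exists>l. (g \<longlongrightarrow> l) (at_left u)" if "0 < u" for u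
        unfolding g_def using that
        by (intro exI[of _ "left_value y u - left_value y' u"] tendsto_diff left_value_tendsto y_mono y_mono')
      show "g a \<le> g b" if ab: "0 \<le> a" "a \<le> b" "b \<le> t" "{a<..b} \<inter> D = {}" for a b
      proof -
        have "{a<..b} \<inter> switches = {}" using ab D(3) by force
        from same_mode[OF ab(1,2) this] show ?thesis
          using y_le[OF ab(1,2)] by (simp add: g_def capped_path_eq)
      qed
      show "0 \<le> g 0" using capped_le[of 0] by (simp add: g_def)
    qed (use D assms in auto)
    then have "sum (jump g) D \<le> g t" using D by (simp add: Int_absorb2)
    moreover have "sum (jump g) D = sum (jump y) D - sum (jump y') D"
      unfolding sum_subtractf[symmetric] using D(2) left_g
      by (intro sum.cong) (auto simp: jump_def g_def)
    ultimately show ?thesis by (simp add: g_def)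
  qed
  have sums: "jump y summable_on {0..t}" "jump y' summable_on {0..t}"
    by (intro jump_summable y_mono y_nonneg y_mono' capped_nonneg assms; assumption)+
  have nonneg: "0 \<le> jump y u" "0 \<le> jump y' u" if "u \<in> {0..t}" for u
    using that by (auto intro!: jump_nonneg y_mono y_nonneg y_mono' capped_nonneg)
  have "infsum (jump y) {0..t} \<le> y t - y' t + infsum (jump y') {0..t}"
  proof (rule infsum_le_finite_sums[OF sums(1)])
    fix D assume D: "finite D" "D \<subseteq> {0..t}"
    \<comment> \<open>Adding the switches only adds nonnegative jumps of \<open>y\<close>, and makes
      \<open>main\<close> applicable.\<close>
    define D' where "D' = D \<union> (switches \<inter> {0..t})"
    have D': "finite D'" "D' \<subseteq> {0..t}" "switches \<inter> {0..t} \<subseteq> D'"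
      using D finite_switches by (auto simp: D'_def)
    have "sum (jump y) D \<le> sum (jump y) D'"
      using D' nonneg by (intro sum_mono2) (auto simp: D'_def)
    also have "\<dots> \<le> y t - y' t + sum (jump y') D'" using main[OF D'] by simp
    also have "sum (jump y') D' \<le> infsum (jump y') {0..t}"
      using D' nonneg sums by (intro finite_sum_le_infsum) auto
    finally show "sum (jump y) D \<le> y t - y' t + infsum (jump y') {0..t}" by simp
  qed
  then show ?thesis by (simp add: continuous_part_def)
qed

end

section \<open>Inventory, ordering times and cost of the capped path\<close>

lemma sum_mult_indicator_infsum:
  fixes a :: ennreal
  assumes "finite (D \<inter> U)"
  shows "(\<Sum>\<^sub>\<infinity>u\<in>U. a * indicator D u) = a * of_nat (card (D \<inter> U))"
proof -
  have "(\<Sum>\<^sub>\<infinity>u\<in>U. a * indicator D u) = (\<Sum>\<^sub>\<infinity>u\<in>D \<inter> U. a)"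
    by (rule infsum_cong_neutral) (auto simp: indicator_def)
  then show ?thesis using assms by (simp add: mult.commute)
qed

context ordering_path
begin

text \<open>A running cycle has not ended, so its inventory \<open>X + c (N t)\<close> is still
  positive. The disjunction is what a comparison through \<open>h\<close>, monotone on
  \<open>{0..}\<close> only, requires.\<close>

lemma inventory_capped:
  assumes "0 \<le> t"
  shows "y' t = y t \<or> (0 \<le> X t + y' t \<and> X t + y' t \<le> X t + y t)"
proof (cases "A (N t) t")
  case True
  have "\<not> X t \<le> - c (N t)"
  proof
    assume "X t \<le> - c (N t)"
    then have "E (Suc (N t)) t" unfolding E_Suc hit_def using True assms by (intro exI[of _ t]) auto
    then show False using not_E_N by blast
  qed
  then show ?thesis using True capped_le[of t] by (simp add: capped_path_eq)
qed (simp add: capped_path_eq)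

text \<open>Outside a cycle the inventory is below \<open>m\<close>, for otherwise a cycle would
  have begun. Inside one the path is constant to the right of \<open>t\<close>, so an ordering time
  must be a genuine jump; as the path is constant from the beginning of the cycle on, that jump
  occurs at the beginning.\<close>

lemma ordering_time_capped:
  assumes "ordering_time y' t"
  shows "X t + y' t \<le> m"
proof -
  have t: "0 \<le> t" and ord: "\<And>u. t < u \<Longrightarrow> left_value y' t < y' u"
    using assms by (auto simp: ordering_time_def)
  have ln: "0 \<le> left_value y' t" by (intro left_value_nonneg y_mono' capped_nonneg)
  show ?thesis
  proof (cases "A (N t) t")
    case False
    have "\<not> m \<le> X t + y t"
    proof
      assume "m \<le> X t + y t"
      then have "A (N t) t" unfolding A_eq hit_def using E_N[OF t] t by (intro exI[of _ t]) auto
      then show False using False by blast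
    qed
    then show ?thesis using False by (simp add: capped_path_eq)
  next
    case True
    obtain e where e: "e > 0" "\<And>s. t \<le> s \<Longrightarrow> s < t + e \<Longrightarrow> N s = N t"
      "\<And>s. t \<le> s \<Longrightarrow> s < t + e \<Longrightarrow> A (N t) s \<longleftrightarrow> A (N t) t"
      using right_mode[OF t] by blast
    have "N (t + e / 2) = N t" "A (N t) (t + e / 2)" using e(2,3)[of "t + e / 2"] e(1) True by auto
    then have after: "y' (t + e / 2) = c (N t)" by (simp add: capped_path_eq)
    have less: "left_value y' t < c (N t)" using ord[of "t + e / 2"] e(1) after by simp
    have "T (N t) \<le> t" using A_first(4)[OF True] True by blast
    moreover have "\<not> T (N t) < t"
    proof
      assume Tt: "T (N t) < t"
      have t0: "0 < t" using Tt A_first(1)[OF True] by linarith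
      have "c (N t) \<le> left_value y' t"
      proof (rule left_value_ge[OF left_value_tendsto[OF y_mono' t0] Tt])
        fix u assume u: "T (N t) < u" "u < t"
        have "A (N t) u" using A_first(4)[OF True] u by simp
        moreover have "N u = N t"
        proof (rule antisym)
          show "N u \<le> N t" using N_mono u by simp
          have "E (N t) u" by (rule A_imp_E) fact
          then show "N t \<le> N u" using less_N_iff by (cases "N t") (auto simp: Suc_le_eq)
        qed
        ultimately show "c (N t) \<le> y' u" by (simp add: capped_path_eq)
      qed
      then show False using less by simp
    qed
    ultimately have "T (N t) = t" by simp
    \<comment> \<open>The level \<open>c (N t)\<close> exceeds a nonnegative left value, hence is
      positive and equal to \<open>m - X t\<close>: the order reaches \<open>m\<close>
      exactly.\<close>
    then show ?thesis using True less ln by (auto simp: capped_path_eq c_eq max_def split: if_splits)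
  qed
qed

text \<open>Since \<open>K\<close> need not be monotone, a jump altered at a switch is charged the
  full bound \<open>Kb\<close>. Every other jump is kept or replaced by 0, where \<open>K\<close>
  vanishes.\<close>

lemma path_cost_capped:
  assumes t: "0 \<le> t" and k: "0 \<le> k"
    and h_mono: "mono_on {0..} h"
    and K0: "K 0 = 0" and K_le: "\<And>\<xi>. 0 \<le> \<xi> \<Longrightarrow> K \<xi> \<le> Kb"
  shows "path_cost h K k (\<lambda>u. X u + y' u) y' t
    \<le> path_cost h K k (\<lambda>u. X u + y u) y t + ennreal Kb * of_nat (2 * N t + 1)"
proof -
  have "0 \<le> Kb" using K_le[of 0] K0 by simp
  have "h (X u + y' u) \<le> h (X u + y u)" if "u \<in> {0..t}" for u
    using inventory_capped[of u] that h_mono by (auto intro: mono_onD)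
  then have "(\<integral>\<^sup>+u\<in>{0..t}. ennreal (h (X u + y' u)) \<partial>lborel) \<le> (\<integral>\<^sup>+u\<in>{0..t}. ennreal (h (X u + y u)) \<partial>lborel)"
    by (intro nn_integral_mono) (auto simp: indicator_def intro: ennreal_leI)
  moreover have "(\<Sum>\<^sub>\<infinity>u\<in>{0..t}. ennreal (K (jump y' u)))
    \<le> (\<Sum>\<^sub>\<infinity>u\<in>{0..t}. ennreal (K (jump y u))) + ennreal Kb * of_nat (2 * N t + 1)"
  proof -
    have "(\<Sum>\<^sub>\<infinity>u\<in>{0..t}. ennreal (K (jump y' u)))
      \<le> (\<Sum>\<^sub>\<infinity>u\<in>{0..t}. ennreal (K (jump y u)) + ennreal Kb * indicator switches u)"
    proof (rule infsum_mono)
      fix u assume u: "u \<in> {0..t}"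
      show "ennreal (K (jump y' u)) \<le> ennreal (K (jump y u)) + ennreal Kb * indicator switches u"
      proof (cases "u \<in> switches")
        case True
        have "0 \<le> jump y' u" using u by (intro jump_nonneg y_mono' capped_nonneg) auto
        then have "ennreal (K (jump y' u)) \<le> ennreal Kb" by (intro ennreal_leI K_le)
        then show ?thesis using True by (simp add: add_increasing)
      next
        case False
        then show ?thesis using jump_capped[of u] u K0 by auto
      qed
    qed (auto intro: nonneg_summable_on_complete)
    also have "\<dots> = (\<Sum>\<^sub>\<infinity>u\<in>{0..t}. ennreal (K (jump y u))) + (\<Sum>\<^sub>\<infinity>u\<in>{0..t}. ennreal Kb * indicator switches u)"
      by (intro infsum_add nonneg_summable_on_complete) auto
    also have "(\<Sum>\<^sub>\<infinity>u\<in>{0..t}. ennreal Kb * indicator switches u) = ennreal Kb * of_nat (card (switches \<inter> {0..t}))"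
      by (rule sum_mult_indicator_infsum) (rule finite_switches)
    also have "\<dots> \<le> ennreal Kb * of_nat (2 * N t + 1)"
      by (intro mult_left_mono of_nat_mono finite_switches) auto
    finally show ?thesis by (simp add: add_left_mono)
  qed
  moreover have "ennreal (k * y' t) \<le> ennreal (k * y t)"
    using capped_le k by (intro ennreal_leI mult_left_mono)
  moreover have "small_order_rate K * ennreal (continuous_part y' t) \<le> small_order_rate K * ennreal (continuous_part y t)"
    using continuous_part_capped_le[OF t] by (intro mult_left_mono ennreal_leI) auto
  ultimately have "path_cost h K k (\<lambda>u. X u + y' u) y' t \<le>
    (\<integral>\<^sup>+u\<in>{0..t}. ennreal (h (X u + y u)) \<partial>lborel)
     + ((\<Sum>\<^sub>\<infinity>u\<in>{0..t}. ennreal (K (jump y u))) + ennreal Kb * of_nat (2 * N t + 1))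
     + ennreal (k * y t) + small_order_rate K * ennreal (continuous_part y t)"
    unfolding path_cost_def by (intro add_mono)
  then show ?thesis unfolding path_cost_def by (simp only: ac_simps)
qed

end

section \<open>Counting disjoint drops\<close>

text \<open>
  The chaining argument: the largest point of the grid of mesh \<open>L / 2 ^ p\<close> in \<open>[a, b]\<close> is joined
  to the smallest one by refining the grid step by step, each refinement adding at most one
  grid interval at either end.
\<close>

lemma grid_chain:
  fixes f :: "real \<Rightarrow> real"
  assumes L: "0 < L" and ab: "0 \<le> a" "a < b"
    and no_multiple: "\<And>j::nat. \<not> (a < real j * L \<and> real j * L \<le> b)"
    and small: "\<And>p k. a \<le> real k * (L / 2 ^ p) \<Longrightarrow> real (Suc k) * (L / 2 ^ p) \<le> b \<Longrightarrow>
      \<bar>f (real (Suc k) * (L / 2 ^ p)) - f (real k * (L / 2 ^ p))\<bar> \<le> d p"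
    and d: "\<And>p. 0 \<le> d p"
    and i: "i = nat \<lceil>a / (L / 2 ^ p)\<rceil>" and j: "j = nat \<lfloor>b / (L / 2 ^ p)\<rfloor>" and "i \<le> j"
  shows "\<bar>f (real j * (L / 2 ^ p)) - f (real i * (L / 2 ^ p))\<bar> \<le> 2 * (\<Sum>q\<le>p. d q)"
  using i j \<open>i \<le> j\<close>
proof (induction p arbitrary: i j)
  case 0
  have jb: "real j * L \<le> b" using L ab 0(2) by (simp add: pos_le_divide_eq[symmetric])
  have ai: "a \<le> real i * L" using L ab 0(1) by (simp add: pos_divide_le_eq[symmetric])
  \<comment> \<open>At the coarsest level only \<open>a\<close> itself can be a grid point, since
    \<open>(a, b]\<close> contains no multiple of \<open>L\<close>.\<close>
  have "i = j"
  proof (rule ccontr)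
    assume "i \<noteq> j"
    then have "real i * L < real j * L" using 0(3) L by simp
    then show False using no_multiple[of j] ai jb by linarith
  qed
  then show ?case using d by simp
next
  case (Suc p)
  define H where "H = L / 2 ^ Suc p"
  have H: "0 < H" "L / 2 ^ p = 2 * H" using L by (auto simp: H_def)
  define i0 where "i0 = nat \<lceil>a / (2 * H)\<rceil>"
  define j0 where "j0 = nat \<lfloor>b / (2 * H)\<rfloor>"
  have ceil: "real (nat \<lceil>v\<rceil>) < v + 1" "v \<le> real (nat \<lceil>v\<rceil>)"
    and floor: "real (nat \<lfloor>v\<rfloor>) \<le> v" "v < real (nat \<lfloor>v\<rfloor>) + 1" if "0 \<le> v" for v :: real
    using that by linarith+
  have lo: "real i < a / H + 1" "a / H \<le> real i" "real j \<le> b / H" "b / H < real j + 1"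
    unfolding Suc(2,3) H_def[symmetric] using ab H by (intro ceil floor; simp)+
  have lo0: "real i0 < a / (2 * H) + 1" "a / (2 * H) \<le> real i0" "real j0 \<le> b / (2 * H)" "b / (2 * H) < real j0 + 1"
    unfolding i0_def j0_def using ab H by (intro ceil floor; simp)+
  have half: "a / (2 * H) = a / H / 2" "b / (2 * H) = b / H / 2" by simp_all
  have "real i < real (2 * i0 + 1)" "real (2 * i0) < real (i + 2)" using lo(1,2) lo0(1,2) unfolding half by simp_all
  \<comment> \<open>Halving the mesh either keeps the first grid point or puts one new point before
    it; likewise for the last point in \<open>j2\<close>.\<close>
  then have i2: "i = 2 * i0 \<or> Suc i = 2 * i0" unfolding of_nat_less_iff by linarith
  have "real (2 * j0) < real (j + 1)" "real j < real (2 * j0 + 2)" using lo(3,4) lo0(3,4) unfolding half by simp_all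
  then have j2: "j = 2 * j0 \<or> j = Suc (2 * j0)" unfolding of_nat_less_iff by linarith
  have aH: "a \<le> real i * H" "real j * H \<le> b" using lo H by (auto simp: field_simps)
  have small': "\<bar>f (real (Suc n) * H) - f (real n * H)\<bar> \<le> d (Suc p)" if "i \<le> n" "Suc n \<le> j" for n
  proof -
    have "real i * H \<le> real n * H" "real (Suc n) * H \<le> real j * H"
      using that H by (auto intro!: mult_right_mono)
    then show ?thesis using small[of n "Suc p"] aH unfolding H_def by linarith
  qed
  have S: "0 \<le> (\<Sum>q\<le>p. d q)" using d by (intro sum_nonneg)
  show ?case
  proof (cases "i0 \<le> j0")
    case True
    have IH: "\<bar>f (real (2 * j0) * H) - f (real (2 * i0) * H)\<bar> \<le> 2 * (\<Sum>q\<le>p. d q)"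
      using Suc(1)[of i0 j0] True H(2) by (simp add: i0_def j0_def mult.assoc mult.left_commute)
    have "\<bar>f (real (2 * i0) * H) - f (real i * H)\<bar> \<le> d (Suc p)"
    proof (cases "i = 2 * i0")
      case False
      then have "Suc i = 2 * i0" "Suc i \<le> j" using i2 j2 True by linarith+
      then show ?thesis using small'[of i] by simp
    qed (use d in simp)
    moreover have "\<bar>f (real j * H) - f (real (2 * j0) * H)\<bar> \<le> d (Suc p)"
    proof (cases "j = 2 * j0")
      case False
      then have "j = Suc (2 * j0)" "i \<le> 2 * j0" using i2 j2 True by linarith+
      then show ?thesis using small'[of "2 * j0"] by simp
    qed (use d in simp)
    ultimately show ?thesis using IH unfolding H_def[symmetric] by simp
  next
    case False
    \<comment> \<open>Without a coarse grid point in \<open>[a, b]\<close>, the finer grid has at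
      most one point there, an odd multiple of \<open>H\<close>.\<close>
    then have "i = j" using i2 j2 Suc(4) by linarith
    then show ?thesis using S d[of "Suc p"] by simp
  qed
qed

text \<open>If all grid increments inside \<open>[a, b]\<close> were small,
  \<open>grid_chain\<close> would bound the increment between the extreme grid points at every
  level. These points converge to \<open>a\<close> and \<open>b\<close> as the mesh tends to zero,
  and continuity of \<open>f\<close> carries the bound over.\<close>

lemma large_grid_increment:
  fixes f :: "real \<Rightarrow> real"
  assumes f: "continuous_on {0..} f" and L: "0 < L" and ab: "0 \<le> a" "a < b"
    and no_multiple: "\<And>j::nat. \<not> (a < real j * L \<and> real j * L \<le> b)"
    and d: "\<And>p. 0 \<le> d p" "summable d" and large: "2 * suminf d < \<bar>f b - f a\<bar>"
  shows "\<exists>p k. a \<le> real k * (L / 2 ^ p) \<and> real (Suc k) * (L / 2 ^ p) \<le> b \<and>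
    d p < \<bar>f (real (Suc k) * (L / 2 ^ p)) - f (real k * (L / 2 ^ p))\<bar>"
proof (rule ccontr)
  assume "\<not> ?thesis"
  then have small: "\<And>p k. a \<le> real k * (L / 2 ^ p) \<Longrightarrow> real (Suc k) * (L / 2 ^ p) \<le> b \<Longrightarrow>
      \<bar>f (real (Suc k) * (L / 2 ^ p)) - f (real k * (L / 2 ^ p))\<bar> \<le> d p" by (meson not_le)
  define s where "s p = real (nat \<lceil>a / (L / 2 ^ p)\<rceil>) * (L / 2 ^ p)" for p
  define t where "t p = real (nat \<lfloor>b / (L / 2 ^ p)\<rfloor>) * (L / 2 ^ p)" for p
  have h: "0 < L / 2 ^ p" for p using L by simp
  have s: "a \<le> s p" "s p \<le> a + L / 2 ^ p" for p
  proof -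
    define v where "v = L / 2 ^ p"
    have v: "0 < v" using h by (simp add: v_def)
    have "a / v \<le> real (nat \<lceil>a / v\<rceil>)" "real (nat \<lceil>a / v\<rceil>) \<le> (a + v) / v"
      unfolding add_divide_distrib using v divide_nonneg_pos[OF ab(1) v] by simp_all
    then show "a \<le> s p" "s p \<le> a + L / 2 ^ p"
      unfolding s_def v_def[symmetric] using v by (simp_all only: pos_divide_le_eq pos_le_divide_eq)
  qed
  have t: "b - L / 2 ^ p \<le> t p" "t p \<le> b" for p
  proof -
    define v where "v = L / 2 ^ p"
    have v: "0 < v" using h by (simp add: v_def)
    have "0 \<le> b / v" using v ab by simp
    then have "(b - v) / v \<le> real (nat \<lfloor>b / v\<rfloor>)" "real (nat \<lfloor>b / v\<rfloor>) \<le> b / v"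
      unfolding diff_divide_distrib using v by simp_all
    then show "b - L / 2 ^ p \<le> t p" "t p \<le> b"
      unfolding t_def v_def[symmetric] using v by (simp_all only: pos_divide_le_eq pos_le_divide_eq)
  qed
  have h0: "(\<lambda>p. L / 2 ^ p) \<longlonglongrightarrow> 0"
    using tendsto_mult_right_zero[OF LIMSEQ_power_zero[of "1 / 2 :: real"], of L] by (simp add: power_divide)
  have "s \<longlonglongrightarrow> a"
    by (rule tendsto_sandwich[of "\<lambda>_. a" _ _ "\<lambda>p. a + L / 2 ^ p"]) (use s tendsto_add[OF tendsto_const h0, of a] in auto)
  moreover have "t \<longlonglongrightarrow> b"
    by (rule tendsto_sandwich[of "\<lambda>p. b - L / 2 ^ p" _ _ "\<lambda>_. b"]) (use t tendsto_diff[OF tendsto_const h0, of b] in auto)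
  moreover have "0 \<le> s p" "0 \<le> t p" for p using L by (simp_all add: s_def t_def)
  ultimately have lim: "(\<lambda>p. \<bar>f (t p) - f (s p)\<bar>) \<longlonglongrightarrow> \<bar>f b - f a\<bar>"
    using ab by (intro tendsto_rabs tendsto_diff continuous_on_tendsto_compose[OF f]) auto
  \<comment> \<open>A mesh below half the length of the interval puts the first grid point before
    the last one.\<close>
  have "\<forall>\<^sub>F p in sequentially. L / 2 ^ p < (b - a) / 2"
    using ab by (intro order_tendstoD(2)[OF h0]) auto
  then have "\<forall>\<^sub>F p in sequentially. \<bar>f (t p) - f (s p)\<bar> \<le> 2 * suminf d"
  proof eventually_elim
    case (elim p)
    define v where "v = L / 2 ^ p"
    have "s p \<le> a + v" "b - v \<le> t p" "v < (b - a) / 2"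
      using s(2)[of p] t(1)[of p] elim by (simp_all only: v_def)
    then have "s p \<le> t p" by argo
    then have le: "nat \<lceil>a / (L / 2 ^ p)\<rceil> \<le> nat \<lfloor>b / (L / 2 ^ p)\<rfloor>"
      unfolding s_def t_def using h[of p] by (subst (asm) mult_le_cancel_right_pos) auto
    have "\<bar>f (t p) - f (s p)\<bar> \<le> 2 * (\<Sum>q\<le>p. d q)"
      unfolding s_def t_def by (rule grid_chain[OF L ab no_multiple small d(1) refl refl le])
    also have "\<dots> \<le> 2 * suminf d" using d by (intro mult_left_mono sum_le_suminf) auto
    finally show ?case .
  qed
  then have "\<bar>f b - f a\<bar> \<le> 2 * suminf d" by (intro tendsto_upperbound[OF lim]) auto
  then show False using large by simp
qed

section \<open>Charging cycles to grid points and grid increments\<close>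

context ordering_path
begin

text \<open>A drop over a multiple of \<open>L\<close> is charged to that multiple, any other drop
  to a large grid increment inside its time interval. The intervals do not overlap, so nothing is
  charged twice.\<close>

lemma N_le_grid_count:
  fixes d :: "nat \<Rightarrow> real"
  assumes L: "0 < L" and t: "0 \<le> t" and d: "\<And>p. 0 \<le> d p" "summable d" "2 * suminf d < m"
  shows "of_nat (N t) \<le> ennreal (t / L) + (\<Sum>p. \<Sum>k<nat \<lfloor>t / (L / 2 ^ p)\<rfloor>.
    if d p < \<bar>X (real (Suc k) * (L / 2 ^ p)) - X (real k * (L / 2 ^ p))\<bar> then 1 else 0)"
    (is "_ \<le> _ + (\<Sum>p. \<Sum>k<?n p. ?ind p k)")
proof -
  have dr: "X (S n) \<le> X (T n) - m" "T n < S n" "S n \<le> t" "0 \<le> T n" if "n < N t" for n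
    using drop[of n t] A_first(1)[of n t] E_Suc_imp_A[of n t] that less_N_iff by auto
  have disj: "S n \<le> T n'" if "n < n'" "n' < N t" for n n'
  proof -
    have "A n' t" using that less_N_iff E_Suc_imp_A by blast
    then have "E (Suc n) (T n')" using A_first(2) E_antimono[of "Suc n" n'] that by auto
    then show ?thesis using E_first(3) by blast
  qed
  \<comment> \<open>Half-open intervals, since one drop may start where the previous one stops. As
    \<open>T n \<ge> 0\<close>, the multiple 0 is excluded and at most \<open>t / L\<close>
    multiples remain.\<close>
  define I1 where "I1 = {n. n < N t \<and> (\<exists>j::nat. T n < real j * L \<and> real j * L \<le> S n)}"
  define I2 where "I2 = {..<N t} - I1"
  have fin: "finite I1" "finite I2" by (auto simp: I1_def I2_def)
  have N: "N t = card I1 + card I2"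
  proof -
    have "I1 \<union> I2 = {..<N t}" "I1 \<inter> I2 = {}" by (auto simp: I1_def I2_def)
    then show ?thesis using card_Un_disjoint[OF fin] by simp
  qed
  have "\<exists>q. \<forall>n\<in>I1. T n < real (q n) * L \<and> real (q n) * L \<le> S n"
    by (intro bchoice) (simp add: I1_def)
  then obtain q :: "nat \<Rightarrow> nat" where q: "\<And>n. n \<in> I1 \<Longrightarrow> T n < real (q n) * L \<and> real (q n) * L \<le> S n"
    by blast
  have "inj_on q I1"
  proof (rule linorder_inj_onI')
    fix n n' assume n: "n \<in> I1" "n' \<in> I1" "n < n'"
    have "real (q n) * L < real (q n') * L"
      using q[OF n(1)] q[OF n(2)] disj[OF n(3)] n(2) by (auto simp: I1_def)
    then show "q n \<noteq> q n'" by auto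
  qed
  moreover have "q ` I1 \<subseteq> {1..nat \<lfloor>t / L\<rfloor>}"
  proof safe
    fix n assume n: "n \<in> I1"
    have "0 < real (q n) * L" using q[OF n] dr(4)[of n] n by (auto simp: I1_def)
    moreover have "real (q n) * L \<le> t" using q[OF n] dr(3)[of n] n by (auto simp: I1_def)
    then have "real (q n) \<le> t / L" using L by (simp add: field_simps)
    ultimately show "q n \<in> {1..nat \<lfloor>t / L\<rfloor>}" using L by (auto simp: zero_less_mult_iff le_nat_iff le_floor_iff)
  qed
  ultimately have "card I1 \<le> nat \<lfloor>t / L\<rfloor>" using card_inj_on_le[of q I1 "{1..nat \<lfloor>t / L\<rfloor>}"] by simp
  moreover have "0 \<le> t / L" using t L by simp
  ultimately have "real (card I1) \<le> t / L" by linarith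
  then have I1: "of_nat (card I1) \<le> ennreal (t / L)"
    unfolding ennreal_of_nat_eq_real_of_nat by (rule ennreal_leI)
  have "\<exists>v. T n \<le> real (snd v) * (L / 2 ^ fst v) \<and> real (Suc (snd v)) * (L / 2 ^ fst v) \<le> S n \<and>
    d (fst v) < \<bar>X (real (Suc (snd v)) * (L / 2 ^ fst v)) - X (real (snd v) * (L / 2 ^ fst v))\<bar>"
    if "n \<in> I2" for n
  proof -
    have n: "n < N t" "\<And>j::nat. \<not> (T n < real j * L \<and> real j * L \<le> S n)"
      using that by (auto simp: I1_def I2_def)
    have "2 * suminf d < \<bar>X (S n) - X (T n)\<bar>" using dr(1)[OF n(1)] d(3) by linarith
    from large_grid_increment[OF X_continuous L dr(4)[OF n(1)] dr(2)[OF n(1)] n(2) d(1,2) this]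
    show ?thesis by auto
  qed
  then obtain v where v: "\<And>n. n \<in> I2 \<Longrightarrow> T n \<le> real (snd (v n)) * (L / 2 ^ fst (v n)) \<and>
    real (Suc (snd (v n))) * (L / 2 ^ fst (v n)) \<le> S n \<and>
    d (fst (v n)) < \<bar>X (real (Suc (snd (v n))) * (L / 2 ^ fst (v n))) - X (real (snd (v n)) * (L / 2 ^ fst (v n)))\<bar>"
    by metis
  have "inj_on v I2"
  proof (rule linorder_inj_onI')
    fix n n' assume n: "n \<in> I2" "n' \<in> I2" "n < n'"
    have "real (Suc (snd (v n))) * (L / 2 ^ fst (v n)) \<le> real (snd (v n')) * (L / 2 ^ fst (v n'))"
      using v[OF n(1)] v[OF n(2)] disj[OF n(3)] n(2) by (auto simp: I2_def)
    moreover have "real k * (L / 2 ^ p) < real (Suc k) * (L / 2 ^ p)" for k p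
      using L by (intro mult_strict_right_mono) auto
    ultimately show "v n \<noteq> v n'" by (metis not_le)
  qed
  then have "card I2 = card (v ` I2)" by (simp add: card_image)
  \<comment> \<open>Finitely many levels are in use, so a partial sum of the series
    suffices.\<close>
  also define P where "P = Max (fst ` v ` I2)"
  have "v ` I2 \<subseteq> (SIGMA p:{..P}. {..<?n p} \<inter> {k. ?ind p k = (1::ennreal)})"
  proof
    fix u assume "u \<in> v ` I2"
    then obtain n where n: "n \<in> I2" "u = v n" by blast
    have "real (Suc (snd u)) * (L / 2 ^ fst u) \<le> t" using v[OF n(1)] dr(3)[of n] n by (auto simp: I2_def)
    then have "real (Suc (snd u)) \<le> t / (L / 2 ^ fst u)" using L by (subst pos_le_divide_eq) auto
    then have "snd u < ?n (fst u)" by linarith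
    moreover have "fst u \<le> P" unfolding P_def using n fin by (intro Max_ge) auto
    moreover have "?ind (fst u) (snd u) = (1::ennreal)" using v[OF n(1)] n(2) by simp
    ultimately have "(fst u, snd u) \<in> (SIGMA p:{..P}. {..<?n p} \<inter> {k. ?ind p k = (1::ennreal)})"
      by blast
    then show "u \<in> (SIGMA p:{..P}. {..<?n p} \<inter> {k. ?ind p k = (1::ennreal)})" by simp
  qed
  then have "card (v ` I2) \<le> card (SIGMA p:{..P}. {..<?n p} \<inter> {k. ?ind p k = (1::ennreal)})"
    by (intro card_mono) auto
  also have "\<dots> = (\<Sum>p\<le>P. card ({..<?n p} \<inter> {k. ?ind p k = (1::ennreal)}))"
    by (intro card_SigmaI) auto
  finally have "of_nat (card I2) \<le> (of_nat (\<Sum>p\<le>P. card ({..<?n p} \<inter> {k. ?ind p k = (1::ennreal)})) :: ennreal)"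
    by (rule of_nat_mono)
  also have "\<dots> = (\<Sum>p\<le>P. \<Sum>k<?n p. ?ind p k)"
    unfolding of_nat_sum by (intro sum.cong refl) (simp add: sum.If_cases)
  also have "\<dots> \<le> (\<Sum>p. \<Sum>k<?n p. ?ind p k)"
    by (intro sum_le_suminf) auto
  finally show ?thesis using I1 unfolding N of_nat_add by (rule add_mono[rotated])
qed

end

section \<open>Adaptedness of the capped policy\<close>

text \<open>Approximate \<open>U\<close> by random times with countably many values and use the
  continuity of the paths.\<close>

lemma measurable_at_random_time:
  fixes f :: "real \<Rightarrow> 'a \<Rightarrow> real"
  assumes f: "\<And>u. 0 \<le> u \<Longrightarrow> u \<le> t \<Longrightarrow> f u \<in> borel_measurable G"
    and cont: "\<And>\<omega>. \<omega> \<in> space G \<Longrightarrow> continuous_on {0..} (\<lambda>u. f u \<omega>)"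
    and U[measurable]: "U \<in> borel_measurable G" and U_le: "\<And>\<omega>. \<omega> \<in> space G \<Longrightarrow> 0 \<le> U \<omega> \<and> U \<omega> \<le> t"
  shows "(\<lambda>\<omega>. f (U \<omega>) \<omega>) \<in> borel_measurable G"
proof (cases "space G = {}")
  case True
  then show ?thesis by (simp add: measurable_def)
next
  case False
  then have t: "0 \<le> t" using U_le by fastforce
  \<comment> \<open>Rounding down keeps to times known at \<open>t\<close>. The minimum with
    \<open>t\<close> gives a measurable function for every \<open>n\<close>, also for those with
    \<open>n / Suc i\<close> beyond \<open>t\<close>.\<close>
  define V where "V i \<omega> = min t (real (nat \<lfloor>real (Suc i) * U \<omega>\<rfloor>) / real (Suc i))" for i \<omega>
  show ?thesis
  proof (rule borel_measurable_LIMSEQ_real)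
    show "(\<lambda>\<omega>. f (V i \<omega>) \<omega>) \<in> borel_measurable G" for i
      unfolding V_def
      by (rule measurable_compose_countable[where f = "\<lambda>n \<omega>. f (min t (real n / real (Suc i))) \<omega>"])
         (use t in \<open>auto intro!: f\<close>)
    fix \<omega> assume \<omega>: "\<omega> \<in> space G"
    have V: "U \<omega> - inverse (real (Suc i)) \<le> V i \<omega>" "V i \<omega> \<le> U \<omega>" for i
    proof -
      define w where "w = real (Suc i)"
      have w: "0 < w" "0 \<le> w * U \<omega>" using U_le[OF \<omega>] by (auto simp: w_def)
      have "real (nat \<lfloor>w * U \<omega>\<rfloor>) \<le> U \<omega> * w" "(U \<omega> - inverse w) * w \<le> real (nat \<lfloor>w * U \<omega>\<rfloor>)"
        unfolding left_diff_distrib using w(1) left_inverse[of w] w(2)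
        by (simp_all add: mult.commute)
      then have "real (nat \<lfloor>w * U \<omega>\<rfloor>) / w \<le> U \<omega>" "U \<omega> - inverse w \<le> real (nat \<lfloor>w * U \<omega>\<rfloor>) / w"
        using w(1) by (simp_all only: pos_divide_le_eq pos_le_divide_eq)
      moreover have "U \<omega> - inverse w \<le> t" using U_le[OF \<omega>] w(1) by (simp add: add_increasing2 diff_le_eq)
      ultimately show "U \<omega> - inverse (real (Suc i)) \<le> V i \<omega>" "V i \<omega> \<le> U \<omega>"
        unfolding V_def w_def[symmetric] by auto
    qed
    have "(\<lambda>i. V i \<omega>) \<longlonglongrightarrow> U \<omega>"
    proof (rule tendsto_sandwich[OF _ _ _ tendsto_const])
      show "(\<lambda>i. U \<omega> - inverse (real (Suc i))) \<longlonglongrightarrow> U \<omega>"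
        using tendsto_diff[OF tendsto_const LIMSEQ_inverse_real_of_nat] by simp
    qed (use V in auto)
    moreover have "0 \<le> V i \<omega>" for i using t by (simp add: V_def)
    ultimately show "(\<lambda>i. f (V i \<omega>) \<omega>) \<longlonglongrightarrow> f (U \<omega>) \<omega>"
      using U_le[OF \<omega>] by (intro continuous_on_tendsto_compose[OF cont[OF \<omega>]]) auto
  qed
qed

text \<open>
  All jumps of \<open>f + g\<close> go upwards. Hence the supremum over a compact interval is attained, and it
  is determined by the rational times and the right end point.
\<close>

lemma hit_iff_rational:
  fixes f g :: "real \<Rightarrow> real"
  assumes f: "continuous_on {0..} f" and g: "mono_on {0..} g" "\<And>s. 0 \<le> s \<Longrightarrow> continuous (at_right s) g"
    and b: "right_closed b" "\<And>s u. b s \<Longrightarrow> s \<le> u \<Longrightarrow> b u" and t: "0 \<le> t"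
  shows "hit (\<lambda>s. b s \<and> m \<le> f s + g s) t \<longleftrightarrow>
    (\<forall>n::nat. \<exists>q\<in>insert t (\<rat> \<inter> {0..t}). b q \<and> m - inverse (real (Suc n)) < f q + g q)"
proof
  assume "hit (\<lambda>s. b s \<and> m \<le> f s + g s) t"
  then obtain s where s: "0 \<le> s" "s \<le> t" "b s" "m \<le> f s + g s" by (auto simp: hit_def)
  show "\<forall>n::nat. \<exists>q\<in>insert t (\<rat> \<inter> {0..t}). b q \<and> m - inverse (real (Suc n)) < f q + g q"
  proof
    fix n :: nat
    show "\<exists>q\<in>insert t (\<rat> \<inter> {0..t}). b q \<and> m - inverse (real (Suc n)) < f q + g q"
    proof (cases "s = t")
      case True
      have "m - inverse (real (Suc n)) < m" by simp
      also note s(4)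
      finally show ?thesis using s(3) True by blast
    next
      case False
      have "((\<lambda>u. f u + g u) \<longlongrightarrow> f s + g s) (at_right s)"
        using continuous_add[OF continuous_on_at_right[OF f s(1)] g(2)[OF s(1)]]
        by (simp add: continuous_within)
      moreover have "m - inverse (real (Suc n)) < f s + g s"
        using s(4) by (intro less_le_trans[OF _ s(4)]) simp
      ultimately have "\<forall>\<^sub>F u in at_right s. m - inverse (real (Suc n)) < f u + g u"
        by (intro order_tendstoD)
      then obtain e where e: "s < e" "\<And>u. s < u \<Longrightarrow> u < e \<Longrightarrow> m - inverse (real (Suc n)) < f u + g u"
        unfolding eventually_at_right_field by blast
      obtain q where "q \<in> \<rat>" "s < q" "q < min e t" using Rats_dense_in_real[of s "min e t"] e(1) s(2) False by auto
      then show ?thesis using e(2)[of q] s(1) b(2)[OF s(3), of q] by (intro bexI[of _ q]) auto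
    qed
  qed
next
  assume "\<forall>n::nat. \<exists>q\<in>insert t (\<rat> \<inter> {0..t}). b q \<and> m - inverse (real (Suc n)) < f q + g q"
  then obtain q where q: "\<And>n. q n \<in> insert t (\<rat> \<inter> {0..t})" "\<And>n. b (q n)"
    "\<And>n. m - inverse (real (Suc n)) < f (q n) + g (q n)"
    by metis
  have q0: "q n \<in> {0..t}" for n using q(1)[of n] t by auto
  \<comment> \<open>Any limit point \<open>s\<close> of times that nearly reach the level will turn
    out to be a hit.\<close>
  have "seq_compact {0..t}" by (simp add: compact_eq_seq_compact_metric[symmetric])
  then obtain s r where s: "s \<in> {0..t}" and r: "strict_mono r" and lim: "(q \<circ> r) \<longlonglongrightarrow> s"
    using q0 unfolding seq_compact_def by metis
  have "b s"
  proof (rule ccontr)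
    assume "\<not> b s"
    then obtain e where e: "e > 0" "\<And>u. s \<le> u \<Longrightarrow> u < s + e \<Longrightarrow> \<not> b u"
      using right_closedD[OF b(1)] s by force
    have "\<forall>\<^sub>F n in sequentially. (q \<circ> r) n < s + e" using e(1) by (intro order_tendstoD(2)[OF lim]) simp
    then obtain n where "q (r n) < s + e" unfolding eventually_sequentially by auto
    then have "b (max s (q (r n)))" "max s (q (r n)) < s + e" using b(2)[OF q(2), of "r n"] e(1) by auto
    then show False using e(2) by (meson max.cobounded1)
  qed
  moreover have "m \<le> f s + g s"
  proof (rule field_le_epsilon)
    fix e :: real assume e: "0 < e"
    have "(g \<longlongrightarrow> g s) (at_right s)" using g(2)[of s] s by (simp add: continuous_within)
    then have "\<forall>\<^sub>F u in at_right s. g u < g s + e / 3" using e by (intro order_tendstoD) auto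
    then obtain w where w: "s < w" "\<And>u. s < u \<Longrightarrow> u < w \<Longrightarrow> g u < g s + e / 3"
      unfolding eventually_at_right_field by blast
    \<comment> \<open>Upper semicontinuity of \<open>g\<close> at \<open>s\<close>: monotonicity
      handles the times before \<open>s\<close>, right-continuity those after it.\<close>
    have gu: "g u \<le> g s + e / 3" if "0 \<le> u" "u < w" for u
      using w(2)[of u] mono_onD[OF g(1), of u s] that s e by (cases "s < u") auto
    have flim: "(\<lambda>n. f ((q \<circ> r) n)) \<longlonglongrightarrow> f s"
      by (rule continuous_on_tendsto_compose[OF f lim]) (use s q0 in auto)
    have "(\<lambda>n. inverse (real (Suc (r n)))) \<longlonglongrightarrow> 0"
      using LIMSEQ_subseq_LIMSEQ[OF LIMSEQ_inverse_real_of_nat r] by (simp add: o_def)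
    then have "\<forall>\<^sub>F n in sequentially. inverse (real (Suc (r n))) < e / 3"
      using e by (intro order_tendstoD) auto
    moreover have "\<forall>\<^sub>F n in sequentially. f ((q \<circ> r) n) < f s + e / 3"
      using e by (intro order_tendstoD(2)[OF flim]) auto
    moreover have "\<forall>\<^sub>F n in sequentially. (q \<circ> r) n < w"
      using w(1) by (intro order_tendstoD(2)[OF lim])
    ultimately have "\<forall>\<^sub>F n in sequentially. m \<le> f s + g s + e"
    proof eventually_elim
      case (elim n)
      have "g (q (r n)) \<le> g s + e / 3" using gu[of "q (r n)"] q0[of "r n"] elim by simp
      then show ?case using q(3)[of "r n"] elim by simp
    qed
    then show "m \<le> f s + g s + e" by simp
  qed
  ultimately show "hit (\<lambda>s. b s \<and> m \<le> f s + g s) t" using s by (auto simp: hit_def)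
qed

section \<open>Measurability of hitting events and frozen levels\<close>

lemma (in filtered_prob_space) space_F: "0 \<le> t \<Longrightarrow> space (F t) = space M"
  using subalgebra_F by (simp add: subalgebra_def)

lemma (in filtered_prob_space) sets_F_mono: "0 \<le> s \<Longrightarrow> s \<le> t \<Longrightarrow> D \<in> sets (F s) \<Longrightarrow> D \<in> sets (F t)"
  using F_mono[of s t] by (auto simp: subalgebra_def)

lemma (in filtered_prob_space) measurable_F_mono:
  "0 \<le> s \<Longrightarrow> s \<le> t \<Longrightarrow> f \<in> measurable (F s) N \<Longrightarrow> f \<in> measurable (F t) N"
  using F_mono measurable_from_subalg by blast

text \<open>By \<open>hit_iff_rational\<close> the event is a countable combination of events at
  times up to \<open>t\<close>. Measurability is asked of the conjunction in \<open>meas\<close>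
  because, for the end of a cycle, \<open>f\<close> contains a level that is known only once the
  cycle has begun.\<close>

lemma (in filtered_prob_space) sets_hit:
  fixes f g :: "'a \<Rightarrow> real \<Rightarrow> real"
  assumes f: "\<And>\<omega>. \<omega> \<in> space M \<Longrightarrow> continuous_on {0..} (f \<omega>)"
    and g: "\<And>\<omega>. \<omega> \<in> space M \<Longrightarrow> mono_on {0..} (g \<omega>)"
      "\<And>\<omega> s. \<omega> \<in> space M \<Longrightarrow> 0 \<le> s \<Longrightarrow> continuous (at_right s) (g \<omega>)"
    and b: "\<And>\<omega>. \<omega> \<in> space M \<Longrightarrow> right_closed (b \<omega>)"
      "\<And>\<omega> s u. \<omega> \<in> space M \<Longrightarrow> b \<omega> s \<Longrightarrow> s \<le> u \<Longrightarrow> b \<omega> u"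
    and meas: "\<And>s a. 0 \<le> s \<Longrightarrow> {\<omega> \<in> space M. b \<omega> s \<and> a < f \<omega> s + g \<omega> s} \<in> sets (F s)"
    and t: "0 \<le> t"
  shows "{\<omega> \<in> space M. hit (\<lambda>s. b \<omega> s \<and> m \<le> f \<omega> s + g \<omega> s) t} \<in> sets (F t)"
proof -
  define Q where "Q = insert t (\<rat> \<inter> {0..t})"
  have Q: "countable Q" unfolding Q_def by (intro countable_insert countable_Int1 countable_rat)
  have "{\<omega> \<in> space M. hit (\<lambda>s. b \<omega> s \<and> m \<le> f \<omega> s + g \<omega> s) t} =
    {\<omega> \<in> space M. \<forall>n::nat. \<exists>q\<in>Q. b \<omega> q \<and> m - inverse (real (Suc n)) < f \<omega> q + g \<omega> q}"
    unfolding Q_def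
  proof (intro Collect_cong conj_cong refl)
    fix \<omega> assume \<omega>: "\<omega> \<in> space M"
    show "hit (\<lambda>s. b \<omega> s \<and> m \<le> f \<omega> s + g \<omega> s) t \<longleftrightarrow>
      (\<forall>n::nat. \<exists>q\<in>insert t (\<rat> \<inter> {0..t}). b \<omega> q \<and> m - inverse (real (Suc n)) < f \<omega> q + g \<omega> q)"
      by (rule hit_iff_rational[OF f[OF \<omega>] g(1)[OF \<omega>] g(2)[OF \<omega>] b(1)[OF \<omega>] b(2)[OF \<omega>] t])
  qed
  also have "\<dots> = (\<Inter>n. \<Union>q\<in>Q. {\<omega> \<in> space M. b \<omega> q \<and> m - inverse (real (Suc n)) < f \<omega> q + g \<omega> q})"
    by auto
  also have "\<dots> \<in> sets (F t)"
    using t by (intro sets.countable_INT' sets.countable_UN' Q image_subsetI)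
      (auto simp: Q_def intro: meas sets_F_mono[OF _ _ meas])
  finally show ?thesis .
qed

locale capped_policy = filtered_prob_space M F
  for M :: "'a measure" and F :: "real \<Rightarrow> 'a measure" +
  fixes m :: real and X Y :: "real \<Rightarrow> 'a \<Rightarrow> real"
  assumes m_pos: "0 < m"
    and X_adapted: "\<And>t. 0 \<le> t \<Longrightarrow> X t \<in> borel_measurable (F t)"
    and X_continuous: "\<And>\<omega>. \<omega> \<in> space M \<Longrightarrow> continuous_on {0..} (\<lambda>t. X t \<omega>)"
    and Y: "Y \<in> admissible_policies M F"
begin

lemma path: "\<omega> \<in> space M \<Longrightarrow> ordering_path m (\<lambda>s. X s \<omega>) (\<lambda>s. Y s \<omega>)"
  using m_pos X_continuous Y by (simp add: ordering_path_def admissible_policies_def)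

abbreviation "ends \<omega> \<equiv> ordering_path.E m (\<lambda>s. X s \<omega>) (\<lambda>s. Y s \<omega>)"
abbreviation "begins \<omega> \<equiv> ordering_path.A m (\<lambda>s. X s \<omega>) (\<lambda>s. Y s \<omega>)"
abbreviation "level \<omega> \<equiv> ordering_path.c m (\<lambda>s. X s \<omega>) (\<lambda>s. Y s \<omega>)"
abbreviation "begin_time \<omega> \<equiv> ordering_path.T m (\<lambda>s. X s \<omega>) (\<lambda>s. Y s \<omega>)"
abbreviation "cycle_count \<omega> \<equiv> ordering_path.N m (\<lambda>s. X s \<omega>) (\<lambda>s. Y s \<omega>)"

lemma A_F:
  assumes "\<And>t. 0 \<le> t \<Longrightarrow> {\<omega> \<in> space M. ends \<omega> n t} \<in> sets (F t)" "0 \<le> t"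
  shows "{\<omega> \<in> space M. begins \<omega> n t} \<in> sets (F t)"
proof -
  have "{\<omega> \<in> space M. begins \<omega> n t} = {\<omega> \<in> space M. hit (\<lambda>s. ends \<omega> n s \<and> m \<le> X s \<omega> + Y s \<omega>) t}"
    using path[THEN ordering_path.A_eq] by (intro Collect_cong conj_cong refl) simp
  also have "\<dots> \<in> sets (F t)"
  proof (rule sets_hit)
    fix s a :: real assume s: "0 \<le> s"
    have [measurable]: "X s \<in> borel_measurable (F s)" "Y s \<in> borel_measurable (F s)"
      using X_adapted[OF s] Y s by (auto simp: admissible_policies_def)
    have "{\<omega> \<in> space (F s). a < X s \<omega> + Y s \<omega>} \<in> sets (F s)" by measurable
    with assms(1)[OF s]
    have "{\<omega> \<in> space M. ends \<omega> n s} \<inter> {\<omega> \<in> space (F s). a < X s \<omega> + Y s \<omega>} \<in> sets (F s)"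
      by (rule sets.Int)
    also have "{\<omega> \<in> space M. ends \<omega> n s} \<inter> {\<omega> \<in> space (F s). a < X s \<omega> + Y s \<omega>}
      = {\<omega> \<in> space M. ends \<omega> n s \<and> a < X s \<omega> + Y s \<omega>}" using space_F[OF s] by auto
    finally show "{\<omega> \<in> space M. ends \<omega> n s \<and> a < X s \<omega> + Y s \<omega>} \<in> sets (F s)" .
  next
    fix \<omega> assume \<omega>: "\<omega> \<in> space M"
    then interpret ordering_path m "\<lambda>s. X s \<omega>" "\<lambda>s. Y s \<omega>" by (rule path)
    show "continuous_on {0..} (\<lambda>s. X s \<omega>)" by (rule X_continuous)
    show "mono_on {0..} (\<lambda>s. Y s \<omega>)" by (rule y_mono)
    show "continuous (at_right s) (\<lambda>s. Y s \<omega>)" if "0 \<le> s" for s using that by (rule y_right_continuous)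
    show "right_closed (E n)" by (rule right_closed_E)
    show "E n u" if "E n s" "s \<le> u" for s u using that by (rule E_mono)
  qed fact
  finally show ?thesis .
qed

text \<open>Before the cycle begins, its level may depend on the future; on the event that it has
  begun by \<open>t\<close>, the level is read off \<open>X\<close> at the begin time. Cut off at
  \<open>t\<close>, this time is measurable: for \<open>0 \<le> r < t\<close> it is at most
  \<open>r\<close> exactly if the cycle has begun by \<open>r\<close>.\<close>

lemma frozen_F:
  assumes A: "\<And>t. 0 \<le> t \<Longrightarrow> {\<omega> \<in> space M. begins \<omega> n t} \<in> sets (F t)" and t: "0 \<le> t"
  obtains f where "f \<in> borel_measurable (F t)" "\<And>\<omega>. \<omega> \<in> space M \<Longrightarrow> begins \<omega> n t \<Longrightarrow> level \<omega> n = f \<omega>"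
proof -
  define U where "U \<omega> = (if begins \<omega> n t then begin_time \<omega> n else t)" for \<omega>
  have U_le: "0 \<le> U \<omega> \<and> U \<omega> \<le> t" if "\<omega> \<in> space M" for \<omega>
    using ordering_path.A_first[OF path[OF that], of n t] t by (auto simp: U_def)
  have "U \<in> borel_measurable (F t)"
  proof (rule borel_measurableI_le)
    fix r
    consider "r < 0" | "0 \<le> r" "r < t" | "t \<le> r" by linarith
    then show "{\<omega> \<in> space (F t). U \<omega> \<le> r} \<in> sets (F t)"
    proof cases
      case 1
      then have "{\<omega> \<in> space (F t). U \<omega> \<le> r} = {}" using U_le space_F[OF t] by (auto simp: not_le intro: less_le_trans)
      then show ?thesis by (simp only: sets.empty_sets)
    next
      case 2
      have "U \<omega> \<le> r \<longleftrightarrow> begins \<omega> n r" if "\<omega> \<in> space M" for \<omega>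
        using ordering_path.A_first(4)[OF path[OF that], of n t r] 2
          ordering_path.A_mono[OF path[OF that], of n r t] by (auto simp: U_def)
      then have "{\<omega> \<in> space (F t). U \<omega> \<le> r} = {\<omega> \<in> space M. begins \<omega> n r}" using space_F[OF t] by auto
      then show ?thesis using sets_F_mono[OF 2(1) _ A[OF 2(1)]] 2(2) by simp
    next
      case 3
      then have "{\<omega> \<in> space (F t). U \<omega> \<le> r} = space (F t)" using U_le space_F[OF t] by (auto intro: order_trans)
      then show ?thesis by simp
    qed
  qed
  note U_measurable = this
  have [measurable]: "(\<lambda>\<omega>. X (U \<omega>) \<omega>) \<in> borel_measurable (F t)"
  proof (rule measurable_at_random_time[where t = t and f = X and U = U, OF _ _ U_measurable])
    show "X u \<in> borel_measurable (F t)" if "0 \<le> u" "u \<le> t" for u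
      using that X_adapted[OF that(1)] by (rule measurable_F_mono)
    show "continuous_on {0..} (\<lambda>u. X u \<omega>)" if "\<omega> \<in> space (F t)" for \<omega>
      using that space_F[OF t] by (intro X_continuous) simp
    show "0 \<le> U \<omega> \<and> U \<omega> \<le> t" if "\<omega> \<in> space (F t)" for \<omega>
      using that space_F[OF t] by (intro U_le) simp
  qed
  show ?thesis
  proof (rule that)
    show "(\<lambda>\<omega>. max 0 (m - X (U \<omega>) \<omega>)) \<in> borel_measurable (F t)" by measurable
    show "level \<omega> n = max 0 (m - X (U \<omega>) \<omega>)" if "\<omega> \<in> space M" "begins \<omega> n t" for \<omega>
      using ordering_path.c_eq[OF path[OF that(1)]] that(2) by (simp add: U_def)
  qed
qed

lemma E_F: "0 \<le> t \<Longrightarrow> {\<omega> \<in> space M. ends \<omega> n t} \<in> sets (F t)"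
proof (induction n arbitrary: t)
  case 0
  have "{\<omega> \<in> space M. ends \<omega> 0 t} = space (F t)"
    using 0 space_F[OF 0] path[THEN ordering_path.E_0] by auto
  then show ?case by simp
next
  case (Suc n)
  have A: "{\<omega> \<in> space M. begins \<omega> n s} \<in> sets (F s)" if "0 \<le> s" for s
    using A_F[of n s] Suc.IH that by blast
  \<comment> \<open>This fits the form of \<open>sets_hit\<close>, with \<open>- X - level\<close>
    as the continuous summand and 0 as the monotone one.\<close>
  have "X s \<omega> \<le> - level \<omega> n \<longleftrightarrow> 0 \<le> (- X s \<omega> - level \<omega> n) + 0" for s \<omega> by linarith
  then have "{\<omega> \<in> space M. ends \<omega> (Suc n) t} = {\<omega> \<in> space M. hit (\<lambda>s. begins \<omega> n s \<and> 0 \<le> (- X s \<omega> - level \<omega> n) + 0) t}"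
    using path[THEN ordering_path.E_Suc] by (intro Collect_cong conj_cong refl) (simp only:)
  also have "\<dots> \<in> sets (F t)"
  proof (rule sets_hit)
    fix s a :: real assume s: "0 \<le> s"
    obtain f where f[measurable]: "f \<in> borel_measurable (F s)"
      and eq: "\<And>\<omega>. \<omega> \<in> space M \<Longrightarrow> begins \<omega> n s \<Longrightarrow> level \<omega> n = f \<omega>"
      using frozen_F[OF A s] by blast
    have [measurable]: "X s \<in> borel_measurable (F s)" by (rule X_adapted[OF s])
    have "{\<omega> \<in> space (F s). a < - X s \<omega> - f \<omega>} \<in> sets (F s)" by measurable
    with A[OF s]
    have "{\<omega> \<in> space M. begins \<omega> n s} \<inter> {\<omega> \<in> space (F s). a < - X s \<omega> - f \<omega>} \<in> sets (F s)"
      by (rule sets.Int)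
    also have "{\<omega> \<in> space M. begins \<omega> n s} \<inter> {\<omega> \<in> space (F s). a < - X s \<omega> - f \<omega>}
      = {\<omega> \<in> space M. begins \<omega> n s \<and> a < (- X s \<omega> - level \<omega> n) + 0}" using space_F[OF s] eq by auto
    finally show "{\<omega> \<in> space M. begins \<omega> n s \<and> a < (- X s \<omega> - level \<omega> n) + 0} \<in> sets (F s)" .
  next
    fix \<omega> assume \<omega>: "\<omega> \<in> space M"
    then interpret ordering_path m "\<lambda>s. X s \<omega>" "\<lambda>s. Y s \<omega>" by (rule path)
    show "continuous_on {0..} (\<lambda>s. - X s \<omega> - c n)" by (intro continuous_intros X_continuous)
    show "right_closed (A n)" by (rule right_closed_A)
    show "A n u" if "A n s" "s \<le> u" for s u using that by (rule A_mono)
  qed (use Suc.prems in \<open>auto intro: mono_onI\<close>)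
  finally show ?case .
qed

lemma capped_adapted:
  assumes t: "0 \<le> t"
  shows "(\<lambda>\<omega>. capped_path m (\<lambda>s. X s \<omega>) (\<lambda>s. Y s \<omega>) t) \<in> borel_measurable (F t)"
proof -
  have E: "Measurable.pred (F t) (\<lambda>\<omega>. ends \<omega> n t)" for n
    unfolding pred_def using E_F[OF t] space_F[OF t] by simp
  have N: "(\<lambda>\<omega>. cycle_count \<omega> t) \<in> measurable (F t) (count_space UNIV)"
  proof (subst measurable_cong)
    show "cycle_count \<omega> t = (LEAST n. \<not> ends \<omega> (Suc n) t)" if "\<omega> \<in> space (F t)" for \<omega>
      using ordering_path.N_eq[OF path] that space_F[OF t] by simp
    show "(\<lambda>\<omega>. LEAST n. \<not> ends \<omega> (Suc n) t) \<in> measurable (F t) (count_space UNIV)"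
      using E by (intro measurable_Least) measurable
  qed
  have "(\<lambda>\<omega>. if begins \<omega> n t then level \<omega> n else Y t \<omega>) \<in> borel_measurable (F t)" for n
  proof -
    obtain f where f: "f \<in> borel_measurable (F t)"
      and eq: "\<And>\<omega>. \<omega> \<in> space M \<Longrightarrow> begins \<omega> n t \<Longrightarrow> level \<omega> n = f \<omega>"
      using frozen_F[OF A_F[OF E_F] t] by blast
    have "Measurable.pred (F t) (\<lambda>\<omega>. begins \<omega> n t)"
      unfolding pred_def using A_F[OF E_F t] space_F[OF t] by simp
    moreover have "Y t \<in> borel_measurable (F t)" using Y t by (auto simp: admissible_policies_def)
    ultimately have "(\<lambda>\<omega>. if begins \<omega> n t then f \<omega> else Y t \<omega>) \<in> borel_measurable (F t)"
      using f by (intro measurable_If) (auto simp: pred_def)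
    then show ?thesis using eq space_F[OF t] by (subst measurable_cong) auto
  qed
  from measurable_compose_countable[OF this N] show ?thesis
    using ordering_path.capped_path_eq[OF path] space_F[OF t] by (subst measurable_cong) auto
qed

end

section \<open>The cost of the capped policy\<close>

text \<open>Here \<open>f\<close> is arbitrary, as the path cost will be, and its integral is a
  supremum over simple functions below it. If \<open>s\<close> is simple and below
  \<open>f + g\<close>, then \<open>s - g\<close> is measurable and below \<open>f\<close>.\<close>

lemma nn_integral_add_le:
  assumes g[measurable]: "g \<in> borel_measurable M"
  shows "(\<integral>\<^sup>+x. f x + g x \<partial>M) \<le> (\<integral>\<^sup>+x. f x \<partial>M) + (\<integral>\<^sup>+x. g x \<partial>M)"
  \<comment> \<open>Finite-valued simple functions avoid the difference \<open>top - top\<close>,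
    which is \<open>top\<close>.\<close>
  unfolding nn_integral_def_finite[of M "\<lambda>x. f x + g x"]
proof (rule SUP_least)
  fix s assume "s \<in> {s. simple_function M s \<and> s \<le> (\<lambda>x. f x + g x) \<and> (\<forall>x. s x < top)}"
  then have s: "simple_function M s" and le: "\<And>x. s x \<le> f x + g x" and fin: "\<And>x. s x \<noteq> top"
    by (auto simp: le_fun_def less_top)
  have [measurable]: "s \<in> borel_measurable M" using s by (rule borel_measurable_simple_function)
  have "integral\<^sup>S M s = (\<integral>\<^sup>+x. s x \<partial>M)" using s by (rule nn_integral_eq_simple_integral[symmetric])
  also have "\<dots> \<le> (\<integral>\<^sup>+x. (s x - g x) + g x \<partial>M)"
    using fin by (intro nn_integral_mono) (metis add.commute ennreal_minus_le_iff order_refl)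
  also have "\<dots> = (\<integral>\<^sup>+x. s x - g x \<partial>M) + (\<integral>\<^sup>+x. g x \<partial>M)" by (intro nn_integral_add) measurable
  also have "(\<integral>\<^sup>+x. s x - g x \<partial>M) \<le> (\<integral>\<^sup>+x. f x \<partial>M)"
    using le fin by (intro nn_integral_mono) (simp add: ennreal_minus_le_iff add.commute)
  finally show "integral\<^sup>S M s \<le> (\<integral>\<^sup>+x. f x \<partial>M) + (\<integral>\<^sup>+x. g x \<partial>M)" by (simp add: add_right_mono)
qed

lemma Limsup_add_le_ennreal:
  fixes a b :: "'i \<Rightarrow> ennreal"
  shows "Limsup G (\<lambda>t. a t + b t) \<le> Limsup G a + Limsup G b"
proof (rule ennreal_le_epsilon)
  fix e :: real assume fin: "Limsup G a + Limsup G b < top" and e: "0 < e"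
  have "u < u + ennreal (e / 2)" if "u < top" for u
    using that e by (cases u) (auto simp flip: ennreal_plus simp: ennreal_less_iff)
  then have "\<forall>\<^sub>F t in G. a t < Limsup G a + ennreal (e / 2)" "\<forall>\<^sub>F t in G. b t < Limsup G b + ennreal (e / 2)"
    using fin by (auto intro!: Limsup_lessD)
  then have "\<forall>\<^sub>F t in G. a t + b t \<le> Limsup G a + Limsup G b + ennreal e"
  proof eventually_elim
    case (elim t)
    have "a t + b t \<le> (Limsup G a + ennreal (e / 2)) + (Limsup G b + ennreal (e / 2))"
      using elim by (intro add_mono) auto
    also have "\<dots> = Limsup G a + Limsup G b + (ennreal (e / 2) + ennreal (e / 2))" by (simp only: ac_simps)
    also have "ennreal (e / 2) + ennreal (e / 2) = ennreal e" using e by (simp flip: ennreal_plus)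
    finally show ?case .
  qed
  then show "Limsup G (\<lambda>t. a t + b t) \<le> Limsup G a + Limsup G b + ennreal e" by (rule Limsup_bounded)
qed

text \<open>About \<open>t / h\<close> grid intervals have length \<open>h\<close>. Second moments
  would bound the number of increments above \<open>d\<close> by order \<open>t / d ^ 2\<close>,
  which is not summable over the levels as \<open>d\<close> tends to 0; fourth moments give order
  \<open>t * h / d ^ 4\<close>, where \<open>h\<close> is halved from level to level.\<close>

lemma (in brownian_motion) increment_fourth_moment:
  assumes "0 \<le> s" "0 < h"
  shows "(\<integral>\<^sup>+\<omega>. ennreal ((B (s + h) \<omega> - B s \<omega>) ^ 4) \<partial>M) = ennreal (3 * h ^ 2)"
proof -
  have D: "distributed M lborel (\<lambda>\<omega>. B (s + h) \<omega> - B s \<omega>) (\<lambda>y. ennreal (normal_density 0 (sqrt h) y))"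
    using normal_increments[of s "s + h"] assms by simp
  have "has_bochner_integral lborel (\<lambda>x. normal_density 0 (sqrt h) x * (x - 0) ^ (2 * 2))
     (fact (2 * 2) / ((2 / (sqrt h)\<^sup>2) ^ 2 * fact 2))"
    using assms by (intro normal_moment_even) simp
  moreover have "fact (2 * 2) / ((2 / (sqrt h)\<^sup>2) ^ 2 * fact 2) = 3 * h ^ 2"
    using assms by (simp add: fact_numeral field_simps)
  ultimately have hb: "has_bochner_integral lborel (\<lambda>x. normal_density 0 (sqrt h) x * x ^ 4) (3 * h ^ 2)"
    by simp
  have "(\<integral>\<^sup>+\<omega>. ennreal ((B (s + h) \<omega> - B s \<omega>) ^ 4) \<partial>M)
    = (\<integral>\<^sup>+x. ennreal (normal_density 0 (sqrt h) x) * ennreal (x ^ 4) \<partial>lborel)"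
    by (rule distributed_nn_integral[OF D, symmetric]) simp
  also have "\<dots> = (\<integral>\<^sup>+x. ennreal (normal_density 0 (sqrt h) x * x ^ 4) \<partial>lborel)"
    by (simp add: ennreal_mult')
  also have "\<dots> = ennreal (3 * h ^ 2)"
    using hb by (intro nn_integral_eq_integral[THEN trans]) (auto simp: has_bochner_integral_iff)
  finally show ?thesis .
qed

lemma fourth_power_sum_le: "(a + b) ^ 4 \<le> 8 * (a ^ 4 + b ^ 4)" for a b :: real
proof -
  have "(a + b)\<^sup>2 \<le> 2 * (a\<^sup>2 + b\<^sup>2)" using sum_squares_bound[of a b] by (simp add: power2_sum)
  then have "((a + b)\<^sup>2)\<^sup>2 \<le> (2 * (a\<^sup>2 + b\<^sup>2))\<^sup>2" by (intro power_mono) auto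
  also have "(2 * (a\<^sup>2 + b\<^sup>2))\<^sup>2 \<le> 8 * ((a\<^sup>2)\<^sup>2 + (b\<^sup>2)\<^sup>2)"
    using sum_squares_bound[of "a\<^sup>2" "b\<^sup>2"] by (simp add: power2_sum power_mult_distrib)
  finally show ?thesis by (simp flip: power_mult)
qed

section \<open>The expected number of cycles under Brownian motion\<close>

locale brownian_policy = brownian_motion M F B
  for M :: "'a measure" and F :: "real \<Rightarrow> 'a measure" and B :: "real \<Rightarrow> 'a \<Rightarrow> real" +
  fixes \<mu> \<sigma> x m :: real and Y :: "real \<Rightarrow> 'a \<Rightarrow> real"
  assumes m_ge_1: "1 \<le> m" and Y_admissible: "Y \<in> admissible_policies M F"
begin

definition X where "X t \<omega> = x - \<mu> * t + \<sigma> * B t \<omega>"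

sublocale capped_policy M F m X Y
proof
  show "X t \<in> borel_measurable (F t)" if "0 \<le> t" for t
    using adapted[OF that] unfolding X_def by measurable
  show "continuous_on {0..} (\<lambda>t. X t \<omega>)" if "\<omega> \<in> space M" for \<omega>
    unfolding X_def by (intro continuous_intros continuous_paths that)
qed (use m_ge_1 Y_admissible in auto)

lemma X_measurable: "0 \<le> t \<Longrightarrow> X t \<in> borel_measurable M"
  using X_adapted subalgebra_F measurable_from_subalg by blast

text \<open>Markov's inequality for the fourth power, with drift and Brownian part separated by
  \<open>fourth_power_sum_le\<close>.\<close>

lemma large_increment_prob:
  assumes "0 \<le> s" "0 < h" "0 < d"
  shows "(\<integral>\<^sup>+\<omega>. (if d < \<bar>X (s + h) \<omega> - X s \<omega>\<bar> then 1 else 0) \<partial>M)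
    \<le> ennreal (8 * (\<mu> ^ 4 * h ^ 4 + 3 * \<sigma> ^ 4 * h ^ 2) / d ^ 4)"
proof -
  have "B t \<in> borel_measurable M" if "0 \<le> t" for t
    using adapted[OF that] subalgebra_F[OF that] measurable_from_subalg by blast
  then have [measurable]: "B (s + h) \<in> borel_measurable M" "B s \<in> borel_measurable M" using assms by auto
  have "(\<integral>\<^sup>+\<omega>. (if d < \<bar>X (s + h) \<omega> - X s \<omega>\<bar> then 1 else 0) \<partial>M)
    \<le> (\<integral>\<^sup>+\<omega>. ennreal (8 * \<mu> ^ 4 * h ^ 4 / d ^ 4) + ennreal (8 * \<sigma> ^ 4 / d ^ 4) * ennreal ((B (s + h) \<omega> - B s \<omega>) ^ 4) \<partial>M)"
  proof (rule nn_integral_mono)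
    fix \<omega>
    define b where "b = B (s + h) \<omega> - B s \<omega>"
    show "(if d < \<bar>X (s + h) \<omega> - X s \<omega>\<bar> then 1 else 0)
      \<le> ennreal (8 * \<mu> ^ 4 * h ^ 4 / d ^ 4) + ennreal (8 * \<sigma> ^ 4 / d ^ 4) * ennreal (b ^ 4)"
    proof (cases "d < \<bar>X (s + h) \<omega> - X s \<omega>\<bar>")
      case True
      have "X (s + h) \<omega> - X s \<omega> = - (\<mu> * h) + \<sigma> * b" by (simp add: X_def b_def algebra_simps)
      then have "d ^ 4 \<le> \<bar>- (\<mu> * h) + \<sigma> * b\<bar> ^ 4" using True assms by (intro power_mono) auto
      also have "\<dots> \<le> 8 * ((- (\<mu> * h)) ^ 4 + (\<sigma> * b) ^ 4)"
        using fourth_power_sum_le by (simp only: power_even_abs even_numeral)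
      finally have "1 \<le> 8 * \<mu> ^ 4 * h ^ 4 / d ^ 4 + 8 * \<sigma> ^ 4 / d ^ 4 * b ^ 4"
        using assms(3) by (simp add: field_simps)
      then have "ennreal 1 \<le> ennreal (8 * \<mu> ^ 4 * h ^ 4 / d ^ 4 + 8 * \<sigma> ^ 4 / d ^ 4 * b ^ 4)"
        by (rule ennreal_leI)
      then show ?thesis using True assms by (simp add: ennreal_plus ennreal_mult'[symmetric])
    qed simp
  qed
  also have "\<dots> = ennreal (8 * \<mu> ^ 4 * h ^ 4 / d ^ 4) + ennreal (8 * \<sigma> ^ 4 / d ^ 4) * ennreal (3 * h ^ 2)"
    using increment_fourth_moment[OF assms(1,2)]
    by (subst nn_integral_add) (auto simp: nn_integral_cmult emeasure_space_1)
  also have "\<dots> = ennreal (8 * (\<mu> ^ 4 * h ^ 4 + 3 * \<sigma> ^ 4 * h ^ 2) / d ^ 4)"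
    using assms by (subst ennreal_mult'[symmetric], simp, subst ennreal_plus[symmetric])
      (auto simp: field_simps)
  finally show ?thesis .
qed

text \<open>The 1 counts the multiples of \<open>m\<close>. In the other term 8 stems from
  \<open>fourth_power_sum_le\<close>, 21 from the thresholds, 3 from the Gaussian fourth moment, and
  \<open>6561 / 1561\<close> is the sum of the geometric series with ratio
  \<open>5000 / 6561\<close>, which is \<open>1 / 2\<close> divided by \<open>(9 / 10) ^ 4\<close>.
  Independence of \<open>m\<close> is the point.\<close>

definition drop_rate where
  "drop_rate = 1 + 8 * 21 ^ 4 * (\<mu> ^ 4 + 3 * \<sigma> ^ 4) * (6561 / 1561)"

text \<open>
  The thresholds \<open>(m / 21) * (9 / 10) ^ p\<close> sum up to less than \<open>m / 2\<close>, and their fourth powers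
  decay more slowly than \<open>(1 / 2) ^ p\<close>.
\<close>

definition grid_count where
  "grid_count t \<omega> = (\<Sum>p. \<Sum>k<nat \<lfloor>t / (m / 2 ^ p)\<rfloor>.
    if m / 21 * (9 / 10) ^ p < \<bar>X (real (Suc k) * (m / 2 ^ p)) \<omega> - X (real k * (m / 2 ^ p)) \<omega>\<bar>
    then 1 else (0::ennreal))"

lemma grid_count_measurable: "grid_count t \<in> borel_measurable M"
proof -
  have [measurable]: "X (real k * (m / 2 ^ p)) \<in> borel_measurable M" for k p
    using m_pos by (intro X_measurable) simp
  show ?thesis unfolding grid_count_def by measurable
qed

lemma cycle_count_le:
  assumes "\<omega> \<in> space M" "0 \<le> t"
  shows "of_nat (cycle_count \<omega> t) \<le> ennreal (t / m) + grid_count t \<omega>"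
  unfolding grid_count_def
proof (rule ordering_path.N_le_grid_count[OF path[OF assms(1)] m_pos assms(2)])
  have s: "(\<lambda>p. m / 21 * (9 / 10) ^ p) sums (m / 21 * (1 / (1 - 9 / 10)))"
    by (intro sums_mult geometric_sums) simp
  show "summable (\<lambda>p. m / 21 * (9 / 10) ^ p)" using s by (rule sums_summable)
  show "2 * (\<Sum>p. m / 21 * (9 / 10) ^ p) < m" using sums_unique[OF s] m_pos by simp
qed (use m_pos in simp)

lemma nn_integral_grid_count_le:
  assumes t: "0 \<le> t"
  shows "(\<integral>\<^sup>+\<omega>. grid_count t \<omega> \<partial>M) \<le> ennreal ((drop_rate - 1) * t / m)"
proof -
  define C where "C = 8 * 21 ^ 4 * (\<mu> ^ 4 + 3 * \<sigma> ^ 4) * t / m"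
  have C: "0 \<le> C" using m_pos t by (auto simp: C_def intro!: divide_nonneg_pos mult_nonneg_nonneg add_nonneg_nonneg)
  have meas[measurable]: "X (real k * (m / 2 ^ p)) \<in> borel_measurable M" for k p
    using m_pos by (intro X_measurable) simp
  have level: "(\<integral>\<^sup>+\<omega>. (\<Sum>k<nat \<lfloor>t / (m / 2 ^ p)\<rfloor>.
      if m / 21 * (9 / 10) ^ p < \<bar>X (real (Suc k) * (m / 2 ^ p)) \<omega> - X (real k * (m / 2 ^ p)) \<omega>\<bar>
      then 1 else (0::ennreal)) \<partial>M) \<le> ennreal (C * (5000 / 6561) ^ p)" for p
  proof -
    define h where "h = m / 2 ^ p"
    define d where "d = m / 21 * (9 / 10) ^ p"
    have h: "0 < h" "h \<le> m" and d: "0 < d"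
      using m_pos by (auto simp: h_def d_def divide_le_eq intro!: mult_le_cancel_left1[THEN iffD2])
    have [measurable]: "X (real k * h) \<in> borel_measurable M" for k using meas by (simp add: h_def)
    have "(\<integral>\<^sup>+\<omega>. (\<Sum>k<nat \<lfloor>t / h\<rfloor>. if d < \<bar>X (real (Suc k) * h) \<omega> - X (real k * h) \<omega>\<bar> then 1 else (0::ennreal)) \<partial>M)
      = (\<Sum>k<nat \<lfloor>t / h\<rfloor>. \<integral>\<^sup>+\<omega>. (if d < \<bar>X (real (Suc k) * h) \<omega> - X (real k * h) \<omega>\<bar> then 1 else 0) \<partial>M)"
      by (rule nn_integral_sum) measurable
    also have "\<dots> \<le> (\<Sum>k<nat \<lfloor>t / h\<rfloor>. ennreal (8 * (\<mu> ^ 4 * h ^ 4 + 3 * \<sigma> ^ 4 * h ^ 2) / d ^ 4))"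
    proof (rule sum_mono)
      fix k show "(\<integral>\<^sup>+\<omega>. (if d < \<bar>X (real (Suc k) * h) \<omega> - X (real k * h) \<omega>\<bar> then 1 else 0) \<partial>M)
        \<le> ennreal (8 * (\<mu> ^ 4 * h ^ 4 + 3 * \<sigma> ^ 4 * h ^ 2) / d ^ 4)"
        using large_increment_prob[of "real k * h" h d] h d by (simp add: distrib_right add.commute)
    qed
    also have "\<dots> = ennreal (real (nat \<lfloor>t / h\<rfloor>) * (8 * (\<mu> ^ 4 * h ^ 4 + 3 * \<sigma> ^ 4 * h ^ 2) / d ^ 4))"
      by (simp only: sum_constant card_lessThan ennreal_of_nat_eq_real_of_nat ennreal_mult'[OF of_nat_0_le_iff])
    also have "\<dots> \<le> ennreal (C * (5000 / 6561) ^ p)"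
    proof (rule ennreal_leI)
      have "real (nat \<lfloor>t / h\<rfloor>) * (8 * (\<mu> ^ 4 * h ^ 4 + 3 * \<sigma> ^ 4 * h ^ 2) / d ^ 4)
        \<le> t / h * (8 * (\<mu> ^ 4 * h ^ 4 + 3 * \<sigma> ^ 4 * h ^ 2) / d ^ 4)"
        using t h d by (intro mult_right_mono) (simp_all add: of_nat_floor)
      also have "\<dots> = 8 * t * h * (\<mu> ^ 4 * h ^ 2 + 3 * \<sigma> ^ 4) / d ^ 4"
      proof -
        have "\<mu> ^ 4 * h ^ 4 + 3 * \<sigma> ^ 4 * h ^ 2 = h * (h * (\<mu> ^ 4 * h ^ 2 + 3 * \<sigma> ^ 4))"
          by algebra
        then show ?thesis using h(1) by simp
      qed
      also have "\<dots> \<le> 8 * t * h * (\<mu> ^ 4 * m ^ 2 + 3 * \<sigma> ^ 4 * m ^ 2) / d ^ 4"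
      proof (intro divide_right_mono mult_left_mono add_mono)
        show "h ^ 2 \<le> m ^ 2" using h by (intro power_mono) auto
        \<comment> \<open>The Brownian term is of lower order in \<open>m\<close> than the drift
          term; \<open>1 \<le> m\<close> brings both to the same power.\<close>
        have "3 * \<sigma> ^ 4 * 1 \<le> 3 * \<sigma> ^ 4 * m ^ 2" using m_ge_1 by (intro mult_left_mono) auto
        then show "3 * \<sigma> ^ 4 \<le> 3 * \<sigma> ^ 4 * m ^ 2" by simp
      qed (use t h in auto)
      also have "\<dots> = 8 * t * (\<mu> ^ 4 + 3 * \<sigma> ^ 4) * m ^ 3 / (2 ^ p * (m / 21 * (9 / 10) ^ p) ^ 4)"
        by (simp add: h_def d_def field_simps power2_eq_square power3_eq_cube)
      also have "(m / 21 * (9 / 10) ^ p) ^ 4 = m ^ 4 / 21 ^ 4 * (6561 / 10000) ^ p"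
        by (simp add: power_mult_distrib power_divide flip: power_mult mult.commute[of 4])
          (simp add: power_mult)
      also have "8 * t * (\<mu> ^ 4 + 3 * \<sigma> ^ 4) * m ^ 3 / (2 ^ p * (m ^ 4 / 21 ^ 4 * (6561 / 10000) ^ p))
        = C * (1 / (2 ^ p * (6561 / 10000) ^ p))"
        using m_pos by (simp add: C_def field_simps power3_eq_cube power4_eq_xxxx)
      also have "1 / (2 ^ p * (6561 / 10000) ^ p) = (5000 / 6561 :: real) ^ p"
      proof -
        have "2 ^ p * (6561 / 10000) ^ p = (6561 / 5000 :: real) ^ p"
          unfolding power_mult_distrib[symmetric] by simp
        then show ?thesis by (simp add: power_divide)
      qed
      finally show "real (nat \<lfloor>t / h\<rfloor>) * (8 * (\<mu> ^ 4 * h ^ 4 + 3 * \<sigma> ^ 4 * h ^ 2) / d ^ 4) \<le> C * (5000 / 6561) ^ p" .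
    qed
    finally show ?thesis by (simp only: h_def d_def)
  qed
  have "(\<integral>\<^sup>+\<omega>. grid_count t \<omega> \<partial>M) = (\<Sum>p. \<integral>\<^sup>+\<omega>. (\<Sum>k<nat \<lfloor>t / (m / 2 ^ p)\<rfloor>.
      if m / 21 * (9 / 10) ^ p < \<bar>X (real (Suc k) * (m / 2 ^ p)) \<omega> - X (real k * (m / 2 ^ p)) \<omega>\<bar>
      then 1 else (0::ennreal)) \<partial>M)"
    unfolding grid_count_def by (rule nn_integral_suminf) measurable
  also have "\<dots> \<le> (\<Sum>p. ennreal (C * (5000 / 6561) ^ p))"
    by (intro suminf_le level) auto
  also have "\<dots> = ennreal (C * (1 / (1 - 5000 / 6561)))"
    using C by (intro suminf_ennreal_eq sums_mult geometric_sums) auto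
  also have "C * (1 / (1 - 5000 / 6561)) = (drop_rate - 1) * t / m"
    using m_pos by (simp add: C_def drop_rate_def field_simps)
  finally show ?thesis .
qed

section \<open>Admissibility and average cost of the capped policy\<close>

definition capped where
  "capped t \<omega> = capped_path m (\<lambda>s. X s \<omega>) (\<lambda>s. Y s \<omega>) t"

lemma capped_admissible: "capped \<in> admissible_policies M F"
proof -
  have "mono_on {0..} (\<lambda>t. capped t \<omega>) \<and> (\<forall>t\<ge>0. 0 \<le> capped t \<omega>) \<and>
    (\<forall>t\<ge>0. continuous (at_right t) (\<lambda>s. capped s \<omega>)) \<and>
    (\<forall>t>0. \<exists>l. ((\<lambda>s. capped s \<omega>) \<longlongrightarrow> l) (at_left t))" if "\<omega> \<in> space M" for \<omega>
  proof -
    interpret ordering_path m "\<lambda>s. X s \<omega>" "\<lambda>s. Y s \<omega>" by (rule path[OF that])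
    show ?thesis unfolding capped_def
      using y_mono' capped_nonneg capped_right_continuous mono_on_left_limit[OF y_mono'] by blast
  qed
  moreover have "capped t \<in> borel_measurable (F t)" if "0 \<le> t" for t
    using capped_adapted[OF that] by (simp add: capped_def[abs_def])
  ultimately show ?thesis by (simp add: admissible_policies_def)
qed

lemma capped_bounded:
  assumes "m = real i"
  shows "capped \<in> bounded_policies M F \<mu> \<sigma> B x i"
  using capped_admissible ordering_path.ordering_time_capped[OF path]
  by (simp add: bounded_policies_def inventory_def capped_def X_def assms[symmetric])

lemma average_cost_capped:
  assumes k: "0 \<le> k" and h_mono: "mono_on {0..} h"
    and K0: "K 0 = 0" and K_le: "\<And>\<xi>. 0 \<le> \<xi> \<Longrightarrow> K \<xi> \<le> Kb"
  shows "average_cost M \<mu> \<sigma> B h K k x capped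
    \<le> average_cost M \<mu> \<sigma> B h K k x Y + ennreal (2 * Kb * drop_rate / m)"
proof -
  have Kb: "0 \<le> Kb" using K_le[of 0] K0 by simp
  have dr: "1 \<le> drop_rate" by (simp add: drop_rate_def)
  define f where "f t \<omega> = path_cost h K k (\<lambda>u. inventory \<mu> \<sigma> B x Y u \<omega>) (\<lambda>u. Y u \<omega>) t" for t \<omega>
  define f' where "f' t \<omega> = path_cost h K k (\<lambda>u. inventory \<mu> \<sigma> B x capped u \<omega>) (\<lambda>u. capped u \<omega>) t" for t \<omega>
  define J where "J t = (\<integral>\<^sup>+\<omega>. f t \<omega> \<partial>M)" for t
  have J: "(\<integral>\<^sup>+\<omega>. f' t \<omega> \<partial>M) \<le> J t + ennreal (2 * Kb * drop_rate * t / m + Kb)" if t: "0 \<le> t" for t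
  proof -
    have [measurable]: "grid_count t \<in> borel_measurable M" by (rule grid_count_measurable)
    have "(\<integral>\<^sup>+\<omega>. f' t \<omega> \<partial>M) \<le> (\<integral>\<^sup>+\<omega>. f t \<omega> + ennreal Kb * (2 * (ennreal (t / m) + grid_count t \<omega>) + 1) \<partial>M)"
    proof (rule nn_integral_mono)
      fix \<omega> assume \<omega>: "\<omega> \<in> space M"
      have "f' t \<omega> \<le> f t \<omega> + ennreal Kb * of_nat (2 * cycle_count \<omega> t + 1)"
        using ordering_path.path_cost_capped[where K = K and h = h, OF path[OF \<omega>] t k h_mono K0 K_le]
        by (simp add: f_def f'_def inventory_def X_def capped_def)
      also have "\<dots> \<le> f t \<omega> + ennreal Kb * (2 * (ennreal (t / m) + grid_count t \<omega>) + 1)"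
        unfolding of_nat_add of_nat_mult of_nat_numeral of_nat_1
        using cycle_count_le[OF \<omega> t] by (intro add_mono mult_mono order_refl) auto
      finally show "f' t \<omega> \<le> f t \<omega> + ennreal Kb * (2 * (ennreal (t / m) + grid_count t \<omega>) + 1)" .
    qed
    also have "\<dots> \<le> J t + (\<integral>\<^sup>+\<omega>. ennreal Kb * (2 * (ennreal (t / m) + grid_count t \<omega>) + 1) \<partial>M)"
      unfolding J_def by (rule nn_integral_add_le) measurable
    also have "(\<integral>\<^sup>+\<omega>. ennreal Kb * (2 * (ennreal (t / m) + grid_count t \<omega>) + 1) \<partial>M)
      = ennreal Kb * (2 * (ennreal (t / m) + (\<integral>\<^sup>+\<omega>. grid_count t \<omega> \<partial>M)) + 1)"
      by (simp add: nn_integral_cmult nn_integral_add emeasure_space_1)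
    also have "\<dots> \<le> ennreal Kb * (2 * (ennreal (t / m) + ennreal ((drop_rate - 1) * t / m)) + 1)"
      using nn_integral_grid_count_le[OF t] by (intro mult_left_mono add_mono order_refl) auto
    also have "\<dots> = ennreal (Kb * (2 * (t / m + (drop_rate - 1) * t / m) + 1))"
    proof -
      have "ennreal Kb * (2 * (ennreal p + ennreal q) + 1) = ennreal (Kb * (2 * (p + q) + 1))"
        if "0 \<le> p" "0 \<le> q" for p q
        using that Kb by (simp add: ennreal_mult' ennreal_plus)
      then show ?thesis using t m_pos dr by simp
    qed
    also have "Kb * (2 * (t / m + (drop_rate - 1) * t / m) + 1) = 2 * Kb * drop_rate * t / m + Kb"
      using m_pos by (simp add: field_simps)
    finally show ?thesis by (simp add: add_left_mono)
  qed
  have "average_cost M \<mu> \<sigma> B h K k x capped = Limsup at_top (\<lambda>t. ennreal (1 / t) * (\<integral>\<^sup>+\<omega>. f' t \<omega> \<partial>M))"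
    by (simp add: average_cost_def f'_def)
  \<comment> \<open>The vanishing summand \<open>Kb / t\<close> pays for the beginning of a cycle
    that is still running at time \<open>t\<close>.\<close>
  also have "\<dots> \<le> Limsup at_top (\<lambda>t. ennreal (1 / t) * J t + ennreal (2 * Kb * drop_rate / m + Kb / t))"
  proof (rule Limsup_mono)
    show "\<forall>\<^sub>F t in at_top. ennreal (1 / t) * (\<integral>\<^sup>+\<omega>. f' t \<omega> \<partial>M)
      \<le> ennreal (1 / t) * J t + ennreal (2 * Kb * drop_rate / m + Kb / t)"
      using eventually_gt_at_top[of 0]
    proof eventually_elim
      case (elim t)
      have "ennreal (1 / t) * (\<integral>\<^sup>+\<omega>. f' t \<omega> \<partial>M)
        \<le> ennreal (1 / t) * (J t + ennreal (2 * Kb * drop_rate * t / m + Kb))"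
        using J[of t] elim by (intro mult_left_mono) auto
      also have "\<dots> = ennreal (1 / t) * J t + ennreal (1 / t * (2 * Kb * drop_rate * t / m + Kb))"
        using elim by (subst ennreal_mult') (auto simp: distrib_left)
      also have "1 / t * (2 * Kb * drop_rate * t / m + Kb) = 2 * Kb * drop_rate / m + Kb / t"
        using elim by (simp add: field_simps)
      finally show ?case .
    qed
  qed
  also have "\<dots> \<le> Limsup at_top (\<lambda>t. ennreal (1 / t) * J t)
    + Limsup at_top (\<lambda>t. ennreal (2 * Kb * drop_rate / m + Kb / t))"
    by (rule Limsup_add_le_ennreal)
  also have "Limsup at_top (\<lambda>t. ennreal (2 * Kb * drop_rate / m + Kb / t)) = ennreal (2 * Kb * drop_rate / m)"
  proof (rule lim_imp_Limsup)
    have "((\<lambda>t. 2 * Kb * drop_rate / m + Kb / t) \<longlongrightarrow> 2 * Kb * drop_rate / m + 0) at_top"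
      by (intro tendsto_intros tendsto_divide_0[OF tendsto_const] filterlim_at_top_imp_at_infinity filterlim_ident)
    then show "((\<lambda>t. ennreal (2 * Kb * drop_rate / m + Kb / t)) \<longlongrightarrow> ennreal (2 * Kb * drop_rate / m)) at_top"
      by (intro tendsto_ennrealI) simp
  qed simp
  finally show ?thesis by (simp add: average_cost_def J_def f_def)
qed

end

section \<open>Infima of the average cost over the policy classes\<close>

lemma no_order_admissible: "(\<lambda>_ _. 0) \<in> admissible_policies M F"
  by (auto simp: admissible_policies_def mono_on_def)

lemma bounded_policies_mono:
  "i \<le> j \<Longrightarrow> bounded_policies M F \<mu> \<sigma> B x i \<subseteq> bounded_policies M F \<mu> \<sigma> B x j"
  by (fastforce simp: bounded_policies_def intro: order_trans)

lemma no_order_bounded: "(\<lambda>_ _. 0) \<in> bounded_policies M F \<mu> \<sigma> B x i"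
proof -
  have "\<not> ordering_time (\<lambda>_. 0) t" for t
  proof -
    have "left_value (\<lambda>_. 0) t = 0"
      using left_value_eqI[of t "\<lambda>_. 0" 0] by (cases "0 < t") (auto simp: left_value_def)
    then show ?thesis using gt_ex[of t] by (simp add: ordering_time_def)
  qed
  then show ?thesis using no_order_admissible by (simp add: bounded_policies_def)
qed

theorem theorem2:
  fixes M :: "'a measure" and F :: "real \<Rightarrow> 'a measure" and B :: "real \<Rightarrow> 'a \<Rightarrow> real"
    and \<mu> \<sigma> k x :: real and K h :: "real \<Rightarrow> real" and Y :: "real \<Rightarrow> 'a \<Rightarrow> real"
  assumes "brownian_motion M F B"
    and "\<mu> > 0" and "\<sigma> > 0" and "k \<ge> 0"
    and K_measurable: "K \<in> borel_measurable (restrict_space borel {0..})"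
    and K_nonneg: "\<And>\<xi>. \<xi> \<ge> 0 \<Longrightarrow> K \<xi> \<ge> 0"
    and K_zero: "K 0 = 0"
    and K_bounded: "bounded (K ` {0..})"
    and K_right_limit: "\<exists>l. (K \<longlongrightarrow> l) (at_right 0)"
    and K_right_deriv: "(K \<longlongrightarrow> 0) (at_right 0) \<Longrightarrow> \<exists>D. (K has_real_derivative D) (at_right 0)"
    and h_measurable: "h \<in> borel_measurable borel"
    and h_nonneg: "\<And>z. h z \<ge> 0"
    and h_mono: "mono_on {0..} h"
    and Y_admissible: "Y \<in> admissible_policies M F"
  shows "\<exists>(Ys :: nat \<Rightarrow> real \<Rightarrow> 'a \<Rightarrow> real) L.
      (\<forall>m\<ge>1. Ys m \<in> bounded_policies M F \<mu> \<sigma> B x m) \<and>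
      (\<lambda>m. average_cost M \<mu> \<sigma> B h K k x (Ys m)) \<longlonglongrightarrow> L \<and>
      L \<le> average_cost M \<mu> \<sigma> B h K k x Y"
proof -
  define U where "U = bounded_policies M F \<mu> \<sigma> B x"
  define AC where "AC = average_cost M \<mu> \<sigma> B h K k x"
  \<comment> \<open>The costs of the capped policies themselves need not converge in
    \<open>m\<close>. Infima over growing classes are monotone and therefore do, and the capped
    policies serve to bound them from above.\<close>
  define a where "a i = (INF Y\<in>U i. AC Y)" for i
  obtain Kb where Kb: "\<And>\<xi>. 0 \<le> \<xi> \<Longrightarrow> K \<xi> \<le> Kb"
    using K_bounded unfolding bounded_iff by (auto dest: abs_le_D1)
  have bound: "a i \<le> AC Y + ennreal (2 * Kb * brownian_policy.drop_rate \<mu> \<sigma> / real i)" if "1 \<le> i" for i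
  proof -
    interpret brownian_policy M F B \<mu> \<sigma> x "real i" Y
      using assms(1) that Y_admissible by (simp add: brownian_policy_def brownian_policy_axioms_def)
    have "capped \<in> U i" unfolding U_def by (rule capped_bounded) simp
    then have "a i \<le> AC capped" unfolding a_def by (rule INF_lower)
    also have "\<dots> \<le> AC Y + ennreal (2 * Kb * drop_rate / real i)"
      unfolding AC_def using \<open>k \<ge> 0\<close> h_mono K_zero Kb by (rule average_cost_capped)
    finally show ?thesis .
  qed
  have "\<exists>Z\<in>U i. AC Z \<le> a i + ennreal (1 / real (Suc i))" for i
  \<comment> \<open>An infinite infimum allows no strict inequality; then any member will do, and
    the policy that never orders belongs to every class.\<close>
  proof (cases "a i = top")
    case True
    then show ?thesis using no_order_bounded unfolding U_def by (intro bexI[of _ "\<lambda>_ _. 0"]) auto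
  next
    case False
    then have "a i < a i + ennreal (1 / real (Suc i))"
      by (cases "a i") (auto simp flip: ennreal_plus simp: ennreal_less_iff)
    then show ?thesis unfolding a_def INF_less_iff by (auto intro: less_imp_le)
  qed
  then obtain Ys where Ys: "\<And>i. Ys i \<in> U i" "\<And>i. AC (Ys i) \<le> a i + ennreal (1 / real (Suc i))"
    by metis
  have "decseq a" unfolding a_def U_def
    by (intro decseq_SucI INF_superset_mono bounded_policies_mono) auto
  then have a: "a \<longlonglongrightarrow> (INF i. a i)" by (rule LIMSEQ_INF)
  have inv: "(\<lambda>i. ennreal (b / real (Suc i))) \<longlonglongrightarrow> 0" for b
  proof -
    have "(\<lambda>i. ennreal (b / real (Suc i))) \<longlonglongrightarrow> ennreal 0"
      using LIMSEQ_Suc[OF lim_const_over_n[of b]] by (rule tendsto_ennrealI)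
    then show ?thesis by simp
  qed
  have upper: "(\<lambda>i. a i + ennreal (1 / real (Suc i))) \<longlonglongrightarrow> (INF i. a i)"
    using tendsto_add[OF a inv[of 1]] by simp
  have lim: "(\<lambda>i. AC (Ys i)) \<longlonglongrightarrow> (INF i. a i)"
    by (rule tendsto_sandwich[OF _ _ a upper]) (use Ys in \<open>auto simp: a_def intro!: always_eventually INF_lower\<close>)
  \<comment> \<open>The index is shifted because \<open>bound\<close> starts at 1.\<close>
  have "(\<lambda>i. AC Y + ennreal (2 * Kb * brownian_policy.drop_rate \<mu> \<sigma> / real (Suc i))) \<longlonglongrightarrow> AC Y + 0"
    by (intro tendsto_add tendsto_const inv)
  then have "(INF i. a i) \<le> AC Y + 0"
  proof (rule LIMSEQ_le_const)
    show "\<exists>n. \<forall>i\<ge>n. (INF i. a i) \<le> AC Y + ennreal (2 * Kb * brownian_policy.drop_rate \<mu> \<sigma> / real (Suc i))"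
      using bound[of "Suc i" for i] by (intro exI[of _ 0] allI impI INF_lower2[of "Suc i" for i]) auto
  qed
  then show ?thesis using Ys(1) lim unfolding U_def AC_def by (intro exI[of _ Ys] exI[of _ "INF i. a i"]) auto
qed

end
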